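(* Let $\mathfrak H=\mathfrak H_1\oplus\mathfrak H_2=\mathfrak H_1'\oplus\mathfrak H_2'$, let $T_{jj}\in[\mathfrak H_j,\mathfrak H_j']$ with $\|T_{jj}\|\le1$, $j\in\{1,2\}$, let $\mathcal H_1:=\overline{\mathrm{ran}}\,D_{T_{11}^*}$, $\mathcal H_2:=\overline{\mathrm{ran}}\,D_{T_{22}}$, and let $K\in[\mathcal H_2,\mathcal H_1]$ be a bounded operator (not necessarily a contraction). Put $$T_K=\begin{pmatrix}T_{11}&D_{T_{11}^*}KD_{T_{22}}\\0&T_{22}\end{pmatrix}:\ \mathfrak H_1\oplus\mathfrak H_2\to\mathfrak H_1'\oplus\mathfrak H_2',$$ $G:=(G_{ij})_{i,j=1}^2=I-T_K^*T_K$ and $S:=(S_{ij})_{i,j=1}^2=I-T_KT_K^*$. Then: (i) $\mathrm{ran}(G_{12})\subset\mathrm{ran}(G_{11}^{1/2})$ and $\mathrm{ran}(S_{21})\subset\mathrm{ran}(S_{22}^{1/2})$, hence the operators $G_{11}^{-1/2}G_{12}$ and $S_{22}^{-1/2}S_{21}$ are well defined and bounded; (ii) the following identities are valid: $$G_{22}-(G_{11}^{-1/2}G_{12})^*(G_{11}^{-1/2}G_{12})=D_{T_{22}}(I-K^*K)D_{T_{22}},$$ $$S_{11}-(S_{22}^{-1/2}S_{21})^*(S_{22}^{-1/2}S_{21})=D_{T_{11}^*}(I-KK^* )D_{T_{11}^*}.$$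
   Context: Hilbert spaces are complex and separable; $[\mathfrak H,\mathfrak K]$ denotes bounded operators from $\mathfrak H$ to $\mathfrak K$. For a contraction $X$, $D_X:=(I-X^*X)^{1/2}$. The matrix of $G$ is with respect to $\mathfrak H_1\oplus\mathfrak H_2$ and that of $S$ with respect to $\mathfrak H_1'\oplus\mathfrak H_2'$; the block $X_{ij}$ maps the $j$-th component to the $i$-th. For $A\ge0$ and $B$ with $\mathrm{ran}\,B\subset\mathrm{ran}\,A^{1/2}$, $A^{-1/2}B$ denotes the operator $Y$ with $A^{1/2}Y=B$ and $\mathrm{ran}\,Y\subset\overline{\mathrm{ran}}\,A$. *)

theory Defs
  imports "HOL-Analysis.Analysis"
begin

(* A complex Hilbert space is a complete real inner product space together with a complex scalar
   multiplication extending the real one and a sesquilinear form, linear in the first argument,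
   whose real part is the real inner product.  The norm and the topology are thus the library's
   ones, with (norm x)^2 = cinner x x. *)
class complex_hilbert = real_inner + complete_space +
  fixes scaleC :: "complex \<Rightarrow> 'a \<Rightarrow> 'a" (infixr "*\<^sub>C" 75)
    and cinner :: "'a \<Rightarrow> 'a \<Rightarrow> complex"
  assumes scaleC_add_right: "a *\<^sub>C (x + y) = a *\<^sub>C x + a *\<^sub>C y"
    and scaleC_add_left: "(a + b) *\<^sub>C x = a *\<^sub>C x + b *\<^sub>C x"
    and scaleC_scaleC: "a *\<^sub>C b *\<^sub>C x = (a * b) *\<^sub>C x"
    and scaleC_of_real: "complex_of_real r *\<^sub>C x = r *\<^sub>R x"
    and cinner_add_left: "cinner (x + y) z = cinner x z + cinner y z"
    and cinner_scaleC_left: "cinner (a *\<^sub>C x) y = a * cinner x y"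
    and cinner_commute: "cinner x y = cnj (cinner y x)"
    and Re_cinner: "Re (cinner x y) = x \<bullet> y"

instantiation complex :: complex_hilbert
begin

definition scaleC_complex :: "complex \<Rightarrow> complex \<Rightarrow> complex"
  where "scaleC_complex a x = a * x"

definition cinner_complex :: "complex \<Rightarrow> complex \<Rightarrow> complex"
  where "cinner_complex x y = x * cnj y"

instance
  by standard
    (auto simp: scaleC_complex_def cinner_complex_def inner_complex_def algebra_simps
      scaleR_conv_of_real)

end

definition closed_csubspace :: "'a::complex_hilbert set \<Rightarrow> bool"
  where "closed_csubspace M \<longleftrightarrow>
    subspace M \<and> (\<forall>c. \<forall>x\<in>M. c *\<^sub>C x \<in> M) \<and> closed M"

(* The whole space is the orthogonal sum of M and N. *)
definition orth_decomp :: "'a::complex_hilbert set \<Rightarrow> 'a set \<Rightarrow> bool"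
  where "orth_decomp M N \<longleftrightarrow>
    closed_csubspace M \<and> closed_csubspace N \<and>
    (\<forall>x\<in>M. \<forall>y\<in>N. cinner x y = 0) \<and>
    {x + y |x y. x \<in> M \<and> y \<in> N} = UNIV"

definition orth_proj :: "'a::complex_hilbert set \<Rightarrow> 'a \<Rightarrow> 'a"
  where "orth_proj M x = (THE u. u \<in> M \<and> (\<forall>v\<in>M. cinner (x - u) v = 0))"

(* An operator between closed subspaces M and N is represented by a function on the ambient space
   of which only the values on M matter; bounded_op M N X says that X (restricted to M) belongs
   to [M, N].  Equality of operators on M is equality at all points of M. *)
definition bounded_op ::
    "'a::complex_hilbert set \<Rightarrow> 'a set \<Rightarrow> ('a \<Rightarrow> 'a) \<Rightarrow> bool"
  where "bounded_op M N X \<longleftrightarrow>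
    (\<forall>x\<in>M. X x \<in> N) \<and>
    (\<forall>x\<in>M. \<forall>y\<in>M. X (x + y) = X x + X y) \<and>
    (\<forall>c. \<forall>x\<in>M. X (c *\<^sub>C x) = c *\<^sub>C X x) \<and>
    (\<exists>C. \<forall>x\<in>M. norm (X x) \<le> C * norm x)"

(* Relative version of the library's onorm; the point 0 contributes 0 / 0 = 0. *)
definition op_norm :: "'a::complex_hilbert set \<Rightarrow> ('a \<Rightarrow> 'a) \<Rightarrow> real"
  where "op_norm M X = (SUP x\<in>M. norm (X x) / norm x)"

(* The adjoint N \<rightarrow> M of an operator X : M \<rightarrow> N.  The value at y in N does not
   depend on N, which is therefore not an argument. *)
definition adj :: "'a::complex_hilbert set \<Rightarrow> ('a \<Rightarrow> 'a) \<Rightarrow> 'a \<Rightarrow> 'a"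
  where "adj M X y = (THE u. u \<in> M \<and> (\<forall>x\<in>M. cinner (X x) y = cinner x u))"

definition positive_op :: "'a::complex_hilbert set \<Rightarrow> ('a \<Rightarrow> 'a) \<Rightarrow> bool"
  where "positive_op M A \<longleftrightarrow> bounded_op M M A \<and>
    (\<forall>x\<in>M. Im (cinner (A x) x) = 0 \<and> 0 \<le> Re (cinner (A x) x))"

(* The positive square root of a positive operator A on M.  It is unique as an operator on M;
   the choice operator only makes a selection of the irrelevant values outside M. *)
definition sqrt_op ::
    "'a::complex_hilbert set \<Rightarrow> ('a \<Rightarrow> 'a) \<Rightarrow> 'a \<Rightarrow> 'a"
  where "sqrt_op M A = (SOME B. positive_op M B \<and> (\<forall>x\<in>M. B (B x) = A x))"

(* D_X = (I - X^* X)^(1/2), an operator on M, for a contraction X defined on M. *)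
definition defect_op ::
    "'a::complex_hilbert set \<Rightarrow> ('a \<Rightarrow> 'a) \<Rightarrow> 'a \<Rightarrow> 'a"
  where "defect_op M X = sqrt_op M (\<lambda>x. x - adj M X (X x))"

(* The relation y = A^(-1/2) b, for A \<ge> 0 acting on N. *)
definition is_inv_sqrt ::
    "'a::complex_hilbert set \<Rightarrow> ('a \<Rightarrow> 'a) \<Rightarrow> 'a \<Rightarrow> 'a \<Rightarrow> bool"
  where "is_inv_sqrt N A b y \<longleftrightarrow> y \<in> closure (A ` N) \<and> sqrt_op N A y = b"

(* A^(-1/2) B, for A \<ge> 0 acting on N and B with values in N: the operator Y with A^(1/2) Y = B
   and range in the closure of ran A.  These conditions are pointwise and determine each Y x,
   since A^(1/2) is injective on the closure of ran A. *)
definition inv_sqrt_comp ::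
    "'a::complex_hilbert set \<Rightarrow> ('a \<Rightarrow> 'a) \<Rightarrow> ('a \<Rightarrow> 'a) \<Rightarrow> 'a \<Rightarrow> 'a"
  where "inv_sqrt_comp N A B x = (THE y. is_inv_sqrt N A (B x) y)"

(* The operator with matrix (X11, X12; X21, X22), where X11, X21 are defined on M1 and X12, X22
   are defined on M2, with respect to an orthogonal decomposition M1, M2 of the domain. *)
definition block_op ::
    "'a::complex_hilbert set \<Rightarrow> 'a set \<Rightarrow> ('a \<Rightarrow> 'a) \<Rightarrow> ('a \<Rightarrow> 'a) \<Rightarrow>
      ('a \<Rightarrow> 'a) \<Rightarrow> ('a \<Rightarrow> 'a) \<Rightarrow> 'a \<Rightarrow> 'a"
  where "block_op M1 M2 X11 X12 X21 X22 x =
    (X11 (orth_proj M1 x) + X12 (orth_proj M2 x)) + (X21 (orth_proj M1 x) + X22 (orth_proj M2 x))"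

(* The matrix entry of X mapping into the component N; the component of the domain on which it
   acts is specified where the entry is used. *)
definition block_entry ::
    "'a::complex_hilbert set \<Rightarrow> ('a \<Rightarrow> 'a) \<Rightarrow> 'a \<Rightarrow> 'a"
  where "block_entry N X x = orth_proj N (X x)"

end

theory Submission
  imports Defs
begin

text \<open>The defect operators intertwine: \<open>T\<^sup>* (I - T T\<^sup>*)^(1/2) = (I - T\<^sup>* T)^(1/2) T\<^sup>*\<close>.  Since
  \<open>G11 = I - T11\<^sup>* T11\<close> and \<open>G12 = - T11\<^sup>* D1 K D2\<close>, this gives \<open>G12 = G11^(1/2) Y\<close> with
  \<open>Y = - T11\<^sup>* K D2\<close>, whose range lies in the closure of the range of \<open>G11\<close>.  The identity for
  \<open>G22 - Y\<^sup>* Y\<close> then follows from \<open>D1\<^sup>2 + T11 T11\<^sup>* = I\<close>, and the identities for \<open>S\<close> are the same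
  argument for \<open>T22\<^sup>*\<close> and \<open>K\<^sup>*\<close> in place of \<open>T11\<close> and \<open>K\<close>.\<close>

subsection \<open>Operators between closed subspaces\<close>

text \<open>The intertwining relation is immediate for the squares, since
  \<open>X' (X X') = (X' X) X'\<close>; the work is to pass to square roots. \<open>sqrt_op\<close>
  is a mere selection, so a root must be constructed, shown to inherit intertwining relations, and
  identified with the selected one. Iterates that are polynomials in \<open>C\<close> serve all
  three purposes. As \<open>C\<close> may have norm 1, their convergence is read off from a monotone
  scalar majorant and not from a strict contraction estimate. A second obstacle is that
  \<open>K\<close> maps into the closure of ran \<open>D1\<close>, not into ran \<open>D1\<close>.
  Membership in the closure of ran \<open>G11\<close> therefore needs a continuity argument together
  with the equality of the closures of the ranges of \<open>A\<close> and \<open>A^(1/2)\<close>.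
  Estimates and adjoint relations are carried out in the real inner product; complex linearity
  recovers the statements about \<open>cinner\<close>.\<close>

lemma scaleC_zero_right [simp]: "c *\<^sub>C 0 = (0::'a::complex_hilbert)"
  using scaleC_add_right[of c 0 "0::'a"] by simp

lemma scaleC_minus_right: "c *\<^sub>C (- x) = - (c *\<^sub>C (x::'a::complex_hilbert))"
  using scaleC_add_right[of c x "-x"] by (simp add: eq_neg_iff_add_eq_0 add.commute)

lemma scaleC_diff_right: "c *\<^sub>C (x - y) = c *\<^sub>C x - c *\<^sub>C (y::'a::complex_hilbert)"
  using scaleC_add_right[of c x "-y"] by (simp add: scaleC_minus_right)

lemma scaleC_scaleR: "c *\<^sub>C (r *\<^sub>R x) = r *\<^sub>R (c *\<^sub>C (x::'a::complex_hilbert))"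
  by (simp add: scaleC_of_real[symmetric] scaleC_scaleC mult.commute)

lemma cinner_scaleC_right: "cinner x (a *\<^sub>C y) = cnj a * cinner x (y::'a::complex_hilbert)"
  by (metis cinner_commute cinner_scaleC_left complex_cnj_mult)

lemma norm_scaleC: "norm (c *\<^sub>C x) = cmod c * norm (x::'a::complex_hilbert)"
proof -
  have "(norm (c *\<^sub>C x))\<^sup>2 = Re (c * cnj c * cinner x x)"
    by (simp only: power2_norm_eq_inner Re_cinner[symmetric] cinner_scaleC_left
        cinner_scaleC_right mult.assoc mult.left_commute[of c])
  also have "\<dots> = (cmod c * norm x)\<^sup>2"
    by (simp add: complex_norm_square[symmetric] power2_norm_eq_inner Re_cinner power_mult_distrib
        del: of_real_power)
  finally show ?thesis by simp
qed

text \<open>This is Im z = - Re (i z) for z = \<open>cinner a b\<close>. Through it, real inner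
  product identities tested at \<open>x\<close> and \<open>\<i> *\<^sub>C x\<close> yield identities
  for \<open>cinner\<close>.\<close>

lemma cinner_eq_inner:
  fixes a b :: "'a::complex_hilbert"
  shows "cinner a b = Complex (a \<bullet> b) (- ((\<i> *\<^sub>C a) \<bullet> b))"
  by (simp add: complex_eq_iff Re_cinner[symmetric] cinner_scaleC_left)

lemma inner_imaginary_unit_swap: "(\<i> *\<^sub>C x) \<bullet> y = - (x \<bullet> (\<i> *\<^sub>C (y::'a::complex_hilbert)))"
  by (simp add: Re_cinner[symmetric] cinner_scaleC_left cinner_scaleC_right)

lemma closed_csubspaceD:
  assumes "closed_csubspace M"
  shows "subspace M" "closed M" "\<And>x. x \<in> M \<Longrightarrow> c *\<^sub>C x \<in> M" "0 \<in> M"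
    "\<And>x y. x \<in> M \<Longrightarrow> y \<in> M \<Longrightarrow> x + y \<in> M"
    "\<And>x y. x \<in> M \<Longrightarrow> y \<in> M \<Longrightarrow> x - y \<in> M"
    "\<And>x. x \<in> M \<Longrightarrow> - x \<in> M"
    "\<And>x r. x \<in> M \<Longrightarrow> r *\<^sub>R x \<in> M"
  using assms unfolding closed_csubspace_def
  by (auto simp: subspace_0 subspace_add subspace_diff subspace_neg subspace_scale)

lemma closed_csubspace_UNIV [simp]: "closed_csubspace (UNIV::'a::complex_hilbert set)"
  by (simp add: closed_csubspace_def)

lemma bounded_opD:
  assumes "bounded_op M N X"
  shows "\<And>x. x \<in> M \<Longrightarrow> X x \<in> N"
    "\<And>x y. x \<in> M \<Longrightarrow> y \<in> M \<Longrightarrow> X (x + y) = X x + X y"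
    "\<And>x c. x \<in> M \<Longrightarrow> X (c *\<^sub>C x) = c *\<^sub>C X x"
    "\<And>x r. x \<in> M \<Longrightarrow> X (r *\<^sub>R x) = r *\<^sub>R X x"
  using assms unfolding bounded_op_def by (auto simp: scaleC_of_real[symmetric])

lemma bounded_opD':
  assumes "bounded_op M N X" "closed_csubspace M"
  shows "X 0 = 0" "\<And>x. x \<in> M \<Longrightarrow> X (- x) = - X x"
    "\<And>x y. x \<in> M \<Longrightarrow> y \<in> M \<Longrightarrow> X (x - y) = X x - X y"
proof -
  note b = bounded_opD[OF assms(1)] and c = closed_csubspaceD[OF assms(2)]
  show "X 0 = 0" using b(4)[of 0 0] c by simp
  show m: "X (- x) = - X x" if "x \<in> M" for x using b(4)[of x "-1"] that by simp
  show "X (x - y) = X x - X y" if "x \<in> M" "y \<in> M" for x y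
    using b(2)[of x "-y"] m that c by simp
qed

lemma bounded_op_bound:
  assumes "bounded_op M N X"
  obtains C where "C > 0" "\<And>x. x \<in> M \<Longrightarrow> norm (X x) \<le> C * norm x"
proof -
  obtain C where C: "\<And>x. x \<in> M \<Longrightarrow> norm (X x) \<le> C * norm x"
    using assms unfolding bounded_op_def by metis
  show thesis
  proof (rule that[of "\<bar>C\<bar> + 1"])
    fix x assume "x \<in> M"
    from C[OF this] show "norm (X x) \<le> (\<bar>C\<bar> + 1) * norm x"
      by (rule order_trans) (auto intro!: mult_right_mono)
  qed auto
qed

lemma bounded_op_cong:
  assumes "bounded_op M N X" "closed_csubspace M" "\<And>x. x \<in> M \<Longrightarrow> X x = X' x"
  shows "bounded_op M N X'"
  using assms unfolding bounded_op_def by (simp add: closed_csubspaceD)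

lemma bounded_op_compose:
  assumes "bounded_op M N X" "bounded_op N P X'"
  shows "bounded_op M P (\<lambda>x. X' (X x))"
proof -
  obtain C where C: "C > 0" "\<And>x. x \<in> M \<Longrightarrow> norm (X x) \<le> C * norm x"
    using bounded_op_bound[OF assms(1)] by blast
  obtain C' where C': "C' > 0" "\<And>x. x \<in> N \<Longrightarrow> norm (X' x) \<le> C' * norm x"
    using bounded_op_bound[OF assms(2)] by blast
  have "norm (X' (X x)) \<le> (C' * C) * norm x" if "x \<in> M" for x
    using order_trans[OF C'(2)[of "X x"] mult_left_mono[OF C(2)[OF that]]] C'(1) that
      bounded_opD(1)[OF assms(1)]
    by (simp add: mult.assoc)
  then show ?thesis
    using assms unfolding bounded_op_def by auto
qed

lemma bounded_op_minus:
  assumes "bounded_op M N X" "closed_csubspace N"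
  shows "bounded_op M N (\<lambda>x. - X x)"
  using assms unfolding bounded_op_def
  by (auto simp: scaleC_minus_right closed_csubspaceD)

lemma bounded_op_diff_id:
  assumes "bounded_op M M X" "closed_csubspace M"
  shows "bounded_op M M (\<lambda>x. x - X x)"
proof -
  obtain C where C: "C > 0" "\<And>x. x \<in> M \<Longrightarrow> norm (X x) \<le> C * norm x"
    using bounded_op_bound[OF assms(1)] by blast
  have "norm (x - X x) \<le> (1 + C) * norm x" if "x \<in> M" for x
    using C(2)[OF that] norm_triangle_ineq4[of x "X x"] by (simp add: algebra_simps)
  then show ?thesis
    using assms unfolding bounded_op_def by (auto simp: scaleC_diff_right closed_csubspaceD)
qed

lemma bounded_op_continuous_on:
  assumes "bounded_op M N X" "closed_csubspace M"
  shows "continuous_on M X"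
proof -
  obtain C where C: "C > 0" "\<And>x. x \<in> M \<Longrightarrow> norm (X x) \<le> C * norm x"
    using bounded_op_bound[OF assms(1)] by blast
  have "C-lipschitz_on M X"
  proof (rule lipschitz_onI)
    fix x y assume "x \<in> M" "y \<in> M"
    then show "dist (X x) (X y) \<le> C * dist x y"
      using C(2)[of "x - y"] by (simp add: dist_norm bounded_opD'[OF assms] closed_csubspaceD[OF assms(2)])
  qed (use C in simp)
  then show ?thesis by (rule lipschitz_on_continuous_on)
qed

text \<open>Continuity lets a vector known only as a limit of range vectors be pushed through a
  further operator.\<close>

lemma bounded_op_closure_image:
  assumes "bounded_op M N X" "closed_csubspace M" "S \<subseteq> M" "x \<in> closure S"
  shows "X x \<in> closure (X ` S)"
proof -
  have "closure S \<subseteq> M"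
    using assms by (simp add: closure_minimal closed_csubspaceD)
  then have "X ` closure S \<subseteq> closure (X ` S)"
    by (intro image_closure_subset closure_subset closed_closure
        continuous_on_subset[OF bounded_op_continuous_on[OF assms(1,2)]])
  then show ?thesis using assms(4) by blast
qed

lemma continuous_on_scaleC: "continuous_on S (\<lambda>x::'a::complex_hilbert. c *\<^sub>C x)"
proof -
  have "bounded_op UNIV UNIV (\<lambda>x::'a. c *\<^sub>C x)"
    unfolding bounded_op_def
    by (auto simp: scaleC_add_right scaleC_scaleC mult.commute norm_scaleC intro!: exI[of _ "cmod c"])
  then show ?thesis
    using bounded_op_continuous_on continuous_on_subset closed_csubspace_UNIV by blast
qed

lemma closure_subspace:
  fixes S :: "'a::real_normed_vector set"
  assumes "subspace S"
  shows "subspace (closure S)"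
proof (rule subspaceI)
  show "0 \<in> closure S"
    using subspace_0[OF assms] closure_subset by blast
next
  fix x y assume "x \<in> closure S" "y \<in> closure S"
  then obtain f g where "\<And>n. f n \<in> S" "f \<longlonglongrightarrow> x" "\<And>n. g n \<in> S" "g \<longlonglongrightarrow> y"
    unfolding closure_sequential by blast
  then show "x + y \<in> closure S"
    unfolding closure_sequential
    by (intro exI[of _ "\<lambda>n. f n + g n"]) (auto intro: subspace_add[OF assms] tendsto_add)
next
  fix c x assume "x \<in> closure S"
  then obtain f where "\<And>n. f n \<in> S" "f \<longlonglongrightarrow> x"
    unfolding closure_sequential by blast
  then show "c *\<^sub>R x \<in> closure S"
    unfolding closure_sequential
    by (intro exI[of _ "\<lambda>n. c *\<^sub>R f n"]) (auto intro: subspace_scale[OF assms] tendsto_scaleR)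
qed

lemma closed_csubspace_closure_image:
  assumes "bounded_op M N X" "closed_csubspace M"
  shows "closed_csubspace (closure (X ` M))"
  unfolding closed_csubspace_def
proof (intro conjI allI ballI closed_closure)
  note b = bounded_opD[OF assms(1)] and c = closed_csubspaceD[OF assms(2)]
  have "subspace (X ` M)"
    unfolding subspace_def using b c bounded_opD'[OF assms] by (auto simp: image_iff) metis+
  then show "subspace (closure (X ` M))" by (rule closure_subspace)
  fix k x assume x: "x \<in> closure (X ` M)"
  have "(\<lambda>x. k *\<^sub>C x) ` closure (X ` M) \<subseteq> closure (X ` M)"
    by (rule image_closure_subset[OF continuous_on_scaleC closed_closure])
      (use b c in \<open>auto intro!: subsetD[OF closure_subset] simp: image_iff; metis\<close>)
  with x show "k *\<^sub>C x \<in> closure (X ` M)" by blast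
qed

text \<open>Riesz representation: the minimiser of \<open>\<parallel>x\<parallel>\<^sup>2 - 2 f x\<close> represents \<open>f\<close>.\<close>

lemma riesz_closed_subspace:
  fixes f :: "'a::complex_hilbert \<Rightarrow> real"
  assumes M: "subspace M" "closed M"
    and add: "\<And>x y. x \<in> M \<Longrightarrow> y \<in> M \<Longrightarrow> f (x + y) = f x + f y"
    and scale: "\<And>x r. x \<in> M \<Longrightarrow> f (r *\<^sub>R x) = r * f x"
    and bound: "\<And>x. x \<in> M \<Longrightarrow> \<bar>f x\<bar> \<le> C * norm x"
  obtains u where "u \<in> M" "\<And>x. x \<in> M \<Longrightarrow> f x = x \<bullet> u"
proof -
  define J where "J x = x \<bullet> x - 2 * f x" for x
  define m where "m = Inf (J ` M)"
  \<comment> \<open>Completing the square: J x is at least (norm x - C)^2 - C^2.\<close>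
  have low: "J x \<ge> - C\<^sup>2" if "x \<in> M" for x
  proof -
    have "f x \<le> C * norm x" using bound[OF that] by simp
    moreover have "0 \<le> (norm x - C)\<^sup>2" by simp
    ultimately show ?thesis unfolding J_def
      by (simp add: power2_norm_eq_inner[symmetric] power2_diff) (simp add: algebra_simps)
  qed
  then have bdd: "bdd_below (J ` M)" by (auto intro!: bdd_belowI2)
  have mle: "m \<le> J x" if "x \<in> M" for x
    unfolding m_def using bdd that by (auto intro: cInf_lower)
  have ne: "J ` M \<noteq> {}" using subspace_0[OF M(1)] by auto
  have "\<exists>x\<in>M. J x < m + inverse (real (Suc n))" for n
    using cInf_lessD[OF ne, of "m + inverse (real (Suc n))"] unfolding m_def by auto
  then obtain z where z: "\<And>n. z n \<in> M" "\<And>n. J (z n) < m + inverse (real (Suc n))"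
    by metis
  \<comment> \<open>The parallelogram law; the linear terms cancel because \<open>f\<close> is
    additive and homogeneous. It forces a minimising sequence to be Cauchy.\<close>
  have par: "(norm (x - y))\<^sup>2 = 2 * J x + 2 * J y - 4 * J ((1/2) *\<^sub>R (x + y))"
    if "x \<in> M" "y \<in> M" for x y
    using that subspace_add[OF M(1)] unfolding J_def
    by (simp add: scale add power2_norm_eq_inner inner_diff inner_add inner_commute[of y x])
       (simp add: field_simps)
  have conv: "\<exists>N. \<forall>n\<ge>N. \<forall>k\<ge>N. norm (z n - z k) < e" if "e > 0" for e
  proof -
    \<comment> \<open>Both J-values exceed \<open>m\<close> by less than 1/(N+1), so
      \<open>par\<close> bounds the squared distance by 4/(N+1).\<close>
    have "e\<^sup>2 / 4 > 0" using that by simp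
    then obtain N where N: "inverse (real (Suc N)) < e\<^sup>2 / 4"
      using reals_Archimedean by blast
    have "norm (z n - z k) < e" if "n \<ge> N" "k \<ge> N" for n k
    proof -
      have i: "inverse (real (Suc n)) \<le> inverse (real (Suc N))"
        "inverse (real (Suc k)) \<le> inverse (real (Suc N))" using that by (auto intro!: le_imp_inverse_le)
      have "m \<le> J ((1/2) *\<^sub>R (z n + z k))"
        by (intro mle subspace_scale[OF M(1)] subspace_add[OF M(1)] z)
      then have "(norm (z n - z k))\<^sup>2 < e\<^sup>2"
        using par[OF z(1) z(1), of n k] z(2)[of n] z(2)[of k] N i by linarith
      then show ?thesis using \<open>e > 0\<close> by (simp add: power2_less_imp_less)
    qed
    then show ?thesis by blast
  qed
  have "Cauchy z" by (rule CauchyI) (rule conv)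
  then obtain u where u: "z \<longlonglongrightarrow> u" using Cauchy_convergent convergent_def by blast
  have uM: "u \<in> M" using closed_sequentially[OF M(2) z(1) u] .
  have flim: "(\<lambda>n. f (z n)) \<longlonglongrightarrow> f u"
  proof (rule Lim_null_comparison[THEN LIM_zero_cancel])
    show "\<forall>\<^sub>F n in sequentially. norm (f (z n) - f u) \<le> C * norm (z n - u)"
    proof (intro always_eventually allI)
      fix n
      have "f (z n - u) = f (z n) - f u"
        using add[of "z n - u" u] z(1) uM M(1) by (simp add: subspace_diff)
      then show "norm (f (z n) - f u) \<le> C * norm (z n - u)"
        using bound[of "z n - u"] z(1) uM M(1) by (simp add: subspace_diff)
    qed
    show "(\<lambda>n. C * norm (z n - u)) \<longlonglongrightarrow> 0"
      using tendsto_mult_right_zero[OF tendsto_norm_zero[OF LIM_zero[OF u]]] .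
  qed
  have "(\<lambda>n. J (z n)) \<longlonglongrightarrow> J u"
    unfolding J_def by (intro tendsto_intros u flim)
  moreover have "(\<lambda>n. m + inverse (real (Suc n))) \<longlonglongrightarrow> m + 0"
    by (intro tendsto_intros LIMSEQ_inverse_real_of_nat)
  ultimately have Ju: "J u \<le> m"
    using z(2) by (intro LIMSEQ_le[where X = "\<lambda>n. J (z n)"]) (auto intro: less_imp_le)
  have "f v = v \<bullet> u" if v: "v \<in> M" for v
  proof -
    define d where "d = v \<bullet> u - f v"
    \<comment> \<open>The right side is J (u + t v) - J u, the first variation at the minimiser plus
      its quadratic remainder.\<close>
    have key: "0 \<le> 2 * t * d + t\<^sup>2 * (v \<bullet> v)" for t
    proof -
      have "J u \<le> J (u + t *\<^sub>R v)"
        using Ju mle[of "u + t *\<^sub>R v"] uM v M(1) by (simp add: subspace_add subspace_scale)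
      then show ?thesis
        using uM v M(1) unfolding J_def d_def
        by (simp add: add scale subspace_scale inner_add inner_commute power2_eq_square algebra_simps)
    qed
    have "d = 0"
    proof (rule ccontr)
      assume "d \<noteq> 0"
      \<comment> \<open>The summand 1 keeps the denominator positive even for v = 0; t = - d / s
        then makes the variation negative.\<close>
      define s where "s = v \<bullet> v + 1"
      have s: "s > 0" using inner_ge_zero[of v] unfolding s_def by linarith
      have "0 \<le> 2 * (- d / s) * d + (- d / s)\<^sup>2 * (v \<bullet> v)" by (rule key)
      also have "\<dots> = (d\<^sup>2 / s\<^sup>2) * (v \<bullet> v - 2 * s)"
        using s by (simp add: field_simps power2_eq_square)
      also have "\<dots> < 0"
      proof (rule mult_pos_neg)
        have *: "a - 2 * (a + 1) < 0" if "a \<ge> 0" for a :: real using that by simp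
        show "v \<bullet> v - 2 * s < 0" unfolding s_def by (rule *[OF inner_ge_zero])
      qed (use s \<open>d \<noteq> 0\<close> in simp)
      finally show False by simp
    qed
    then show ?thesis by (simp add: d_def)
  qed
  with uM show thesis by (rule that)
qed

section \<open>Adjoints between closed subspaces\<close>

text \<open>As a relation between two complex-linear maps, adjointness needs only the real inner
  product, and it is closed under swapping and composition without any appeal to the description
  operator in \<open>adj\<close>.\<close>

definition adjoint_on :: "'a::complex_hilbert set \<Rightarrow> 'a set \<Rightarrow> ('a \<Rightarrow> 'a) \<Rightarrow> ('a \<Rightarrow> 'a) \<Rightarrow> bool"
  where "adjoint_on M N X X' \<longleftrightarrow> bounded_op M N X \<and> bounded_op N M X' \<and>
    (\<forall>x\<in>M. \<forall>y\<in>N. X x \<bullet> y = x \<bullet> X' y)"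

lemma adjoint_onD:
  assumes "adjoint_on M N X X'"
  shows "bounded_op M N X" "bounded_op N M X'"
    "\<And>x y. x \<in> M \<Longrightarrow> y \<in> N \<Longrightarrow> X x \<bullet> y = x \<bullet> X' y"
  using assms unfolding adjoint_on_def by auto

lemma inner_eq_imp_eq:
  assumes "closed_csubspace M" "u \<in> M" "v \<in> M" "\<And>x. x \<in> M \<Longrightarrow> x \<bullet> u = x \<bullet> v"
  shows "u = v"
proof -
  have "(u - v) \<bullet> u = (u - v) \<bullet> v"
    by (intro assms(4) closed_csubspaceD(6)[OF assms(1)] assms(2,3))
  then show ?thesis by (metis inner_diff_right inner_eq_zero_iff right_minus_eq)
qed

text \<open>Testing at \<open>\<i> *\<^sub>C x\<close> supplies the imaginary part, so the
  \<open>cinner\<close> condition in \<open>adj\<close> follows from a real one.\<close>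

lemma adj_eqI:
  assumes M: "closed_csubspace M" and X: "\<And>x c. x \<in> M \<Longrightarrow> X (c *\<^sub>C x) = c *\<^sub>C X x"
    and u: "u \<in> M" and eq: "\<And>x. x \<in> M \<Longrightarrow> X x \<bullet> y = x \<bullet> u"
  shows "adj M X y = u"
  unfolding adj_def
proof (rule the_equality)
  show "u \<in> M \<and> (\<forall>x\<in>M. cinner (X x) y = cinner x u)"
  proof (intro conjI ballI u)
    fix x assume x: "x \<in> M"
    have "(\<i> *\<^sub>C X x) \<bullet> y = (\<i> *\<^sub>C x) \<bullet> u"
      using X[OF x, of \<i>] eq[OF closed_csubspaceD(3)[OF M x]] by metis
    then show "cinner (X x) y = cinner x u"
      by (simp only: cinner_eq_inner eq[OF x])
  qed
  fix v assume v: "v \<in> M \<and> (\<forall>x\<in>M. cinner (X x) y = cinner x v)"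
  have "x \<bullet> v = x \<bullet> u" if "x \<in> M" for x
  proof -
    have "Re (cinner x v) = Re (cinner (X x) y)" using v that by simp
    then show ?thesis unfolding Re_cinner using eq[OF that] by simp
  qed
  with v u show "v = u" by (intro inner_eq_imp_eq[OF M]) simp_all
qed

lemma adj_eq:
  assumes "adjoint_on M N X X'" "closed_csubspace M" "y \<in> N"
  shows "adj M X y = X' y"
proof (rule adj_eqI[OF assms(2)])
  have X: "bounded_op M N X" "bounded_op N M X'" using assms(1) unfolding adjoint_on_def by auto
  show "X (c *\<^sub>C x) = c *\<^sub>C X x" if "x \<in> M" for x c by (rule bounded_opD(3)[OF X(1) that])
  show "X' y \<in> M" by (rule bounded_opD(1)[OF X(2) assms(3)])
  show "X x \<bullet> y = x \<bullet> X' y" if "x \<in> M" for x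
    using assms that unfolding adjoint_on_def by blast
qed

text \<open>Riesz representation of \<open>\<lambda>x. X x \<bullet> y\<close> gives each value of
  the adjoint, and testing at that value itself gives the norm bound.\<close>

lemma adjoint_on_adj:
  assumes X: "bounded_op M N X" and M: "closed_csubspace M"
  shows "adjoint_on M N X (adj M X)"
proof -
  note b = bounded_opD[OF X] and c = closed_csubspaceD[OF M]
  obtain C where C: "C > 0" "\<And>x. x \<in> M \<Longrightarrow> norm (X x) \<le> C * norm x"
    using bounded_op_bound[OF X] by blast
  have ex: "adj M X y \<in> M \<and> (\<forall>x\<in>M. X x \<bullet> y = x \<bullet> adj M X y)" for y
  proof -
    have "\<bar>X x \<bullet> y\<bar> \<le> (C * norm y) * norm x" if "x \<in> M" for x
      using Cauchy_Schwarz_ineq2[of "X x" y] mult_right_mono[OF C(2)[OF that], of "norm y"]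
      by (simp add: algebra_simps)
    then obtain u where u: "u \<in> M" "\<And>x. x \<in> M \<Longrightarrow> X x \<bullet> y = x \<bullet> u"
      by (rule riesz_closed_subspace[OF c(1,2), where f = "\<lambda>x. X x \<bullet> y", rotated 2])
        (simp_all add: b(2,4) inner_add_left)
    have "adj M X y = u" by (rule adj_eqI[OF M b(3) u])
    with u show ?thesis by blast
  qed
  have "bounded_op N M (adj M X)"
    unfolding bounded_op_def
  proof (intro conjI ballI allI exI)
    fix x y assume "x \<in> N" "y \<in> N"
    show "adj M X x \<in> M" using ex by blast
    show "adj M X (x + y) = adj M X x + adj M X y"
      by (rule adj_eqI[OF M b(3)]) (simp_all add: ex c(5) inner_add_right)
  next
    fix k x assume "x \<in> N"
    have "X z \<bullet> (k *\<^sub>C x) = z \<bullet> (k *\<^sub>C adj M X x)" if "z \<in> M" for z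
    proof -
      have adjk: "w \<bullet> (k *\<^sub>C y) = (cnj k *\<^sub>C w) \<bullet> y" for w y :: 'a
        by (simp add: Re_cinner[symmetric] cinner_scaleC_left cinner_scaleC_right)
      have "(cnj k *\<^sub>C X z) \<bullet> x = (cnj k *\<^sub>C z) \<bullet> adj M X x"
        using ex[of x] b(3)[OF that, of "cnj k"] c(3)[OF that, of "cnj k"] by metis
      then show ?thesis unfolding adjk .
    qed
    then show "adj M X (k *\<^sub>C x) = k *\<^sub>C adj M X x"
      by (intro adj_eqI[OF M b(3)]) (simp_all add: ex c(3))
  next
    fix y assume "y \<in> N"
    let ?u = "adj M X y"
    have "(norm ?u)\<^sup>2 = X ?u \<bullet> y" using ex[of y] by (simp add: power2_norm_eq_inner)
    also have "\<dots> \<le> norm (X ?u) * norm y" by (rule norm_cauchy_schwarz)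
    also have "\<dots> \<le> (C * norm ?u) * norm y" using C(2)[of ?u] ex[of y] by (intro mult_right_mono) auto
    finally have "norm ?u * norm ?u \<le> norm ?u * (C * norm y)" by (simp add: power2_eq_square algebra_simps)
    then show "norm ?u \<le> C * norm y"
      using C(1) by (cases "norm ?u = 0") (auto simp: mult_le_cancel_left)
  qed
  then show ?thesis using X ex unfolding adjoint_on_def by blast
qed

lemma adjoint_on_sym:
  assumes "adjoint_on M N X X'"
  shows "adjoint_on N M X' X"
  using assms unfolding adjoint_on_def by (auto simp: inner_commute)

lemma adjoint_on_compose:
  assumes "adjoint_on M N X X'" "adjoint_on N P V V'"
  shows "adjoint_on M P (\<lambda>x. V (X x)) (\<lambda>y. X' (V' y))"
  using assms unfolding adjoint_on_def
  by (auto intro: bounded_op_compose simp: bounded_opD)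

section \<open>Orthogonal projections and decompositions\<close>

lemma orth_proj_eqI:
  assumes "closed_csubspace M" "u \<in> M" "\<And>v. v \<in> M \<Longrightarrow> cinner (x - u) v = 0"
  shows "orth_proj M x = u"
  unfolding orth_proj_def
proof (rule the_equality)
  show "u \<in> M \<and> (\<forall>v\<in>M. cinner (x - u) v = 0)" using assms by blast
  fix w assume w: "w \<in> M \<and> (\<forall>v\<in>M. cinner (x - w) v = 0)"
  have "v \<bullet> w = v \<bullet> u" if "v \<in> M" for v
  proof -
    have "(x - w) \<bullet> v = 0" "(x - u) \<bullet> v = 0"
      using w assms(3) that by (simp_all add: Re_cinner[symmetric])
    then show ?thesis by (simp add: inner_diff_left inner_commute[of v])
  qed
  with w assms(2) show "w = u" by (intro inner_eq_imp_eq[OF assms(1)]) simp_all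
qed

text \<open>\<open>v\<close> is the Riesz representative on \<open>V\<close> of the functional
  \<open>z \<bullet> x\<close>.\<close>

lemma orthogonal_split:
  assumes "closed_csubspace V"
  obtains v w where "x = v + w" "v \<in> V" "\<forall>z\<in>V. w \<bullet> z = 0"
proof -
  note c = closed_csubspaceD[OF assms]
  have "\<bar>z \<bullet> x\<bar> \<le> norm x * norm z" for z
    using Cauchy_Schwarz_ineq2[of z x] by (simp add: mult.commute)
  then obtain v where v: "v \<in> V" "\<And>z. z \<in> V \<Longrightarrow> z \<bullet> x = z \<bullet> v"
    by (rule riesz_closed_subspace[OF c(1,2), where f = "\<lambda>z. z \<bullet> x", rotated 2])
      (simp_all add: inner_add_left)
  show thesis
  proof (rule that[of v "x - v"])
    show "\<forall>z\<in>V. (x - v) \<bullet> z = 0"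
      using v(2) by (metis inner_commute inner_diff_left right_minus_eq)
  qed (simp_all add: v(1))
qed

lemma orth_decomp_sym: "orth_decomp M N \<Longrightarrow> orth_decomp N M"
  unfolding orth_decomp_def
  by (simp add: set_eq_iff) (metis add.commute cinner_commute complex_cnj_zero)

lemma orth_decomp_proj:
  assumes "orth_decomp M N" "x \<in> M" "y \<in> N"
  shows "orth_proj M (x + y) = x" "orth_proj N (x + y) = y"
    "orth_proj M x = x" "orth_proj N y = y" "orth_proj M y = 0" "orth_proj N x = 0"
proof -
  have *: "orth_proj M (x + y) = x" if "orth_decomp M N" "x \<in> M" "y \<in> N" for M N and x y :: 'a
    by (rule orth_proj_eqI)
      (use that in \<open>auto simp: orth_decomp_def cinner_commute[of y]\<close>)
  have z: "0 \<in> M" "0 \<in> N" using assms closed_csubspaceD unfolding orth_decomp_def by auto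
  note s = orth_decomp_sym[OF assms(1)]
  show "orth_proj M (x + y) = x" "orth_proj M x = x" "orth_proj M y = 0"
    using *[OF assms] *[OF assms(1,2) z(2)] *[OF assms(1) z(1) assms(3)] by simp_all
  show "orth_proj N (x + y) = y" "orth_proj N y = y" "orth_proj N x = 0"
    using *[OF s assms(3,2)] *[OF s assms(3) z(1)] *[OF s z(2) assms(2)] by (simp_all add: add.commute)
qed

lemma orth_decomp_inner:
  assumes "orth_decomp M N" "x \<in> M" "y \<in> N"
  shows "x \<bullet> y = 0" "y \<bullet> x = 0"
proof -
  show "x \<bullet> y = 0" using assms unfolding orth_decomp_def by (simp add: Re_cinner[symmetric])
  then show "y \<bullet> x = 0" by (simp add: inner_commute)
qed

lemma orth_decomp_cases:
  assumes "orth_decomp M N"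
  obtains x y where "z = x + y" "x \<in> M" "y \<in> N"
proof -
  have "z \<in> {x + y |x y. x \<in> M \<and> y \<in> N}" using assms unfolding orth_decomp_def by simp
  then show thesis using that by blast
qed

text \<open>A real supremum dominates its members only when the family is bounded above, which the
  operator bound \<open>C\<close> guarantees.\<close>

lemma op_norm_le_1D:
  assumes "bounded_op M N X" "op_norm M X \<le> 1" "x \<in> M" "closed_csubspace M"
  shows "norm (X x) \<le> norm x"
proof (cases "x = 0")
  case True
  then show ?thesis using bounded_opD'[OF assms(1,4)] by simp
next
  case False
  obtain C where C: "C > 0" "\<And>x. x \<in> M \<Longrightarrow> norm (X x) \<le> C * norm x"
    using bounded_op_bound[OF assms(1)] by blast
  have "norm (X y) / norm y \<le> C" if "y \<in> M" for y
    using C(2)[OF that] C(1) by (cases "y = 0") (auto simp: divide_simps)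
  then have "bdd_above ((\<lambda>x. norm (X x) / norm x) ` M)" by (rule bdd_aboveI2)
  then have "norm (X x) / norm x \<le> op_norm M X"
    unfolding op_norm_def using assms(3) by (rule cSUP_upper2) simp
  with assms(2) have "norm (X x) / norm x \<le> 1" by simp
  then show ?thesis using False by simp
qed

subsection \<open>Square roots of positive operators\<close>

text \<open>The roots needed later are of I - C with C = X' X or X X' for a contraction X, and such
  C are of this kind.\<close>

definition symmetric_contraction :: "'a::complex_hilbert set \<Rightarrow> ('a \<Rightarrow> 'a) \<Rightarrow> bool"
  where "symmetric_contraction M C \<longleftrightarrow> adjoint_on M M C C \<and> (\<forall>x\<in>M. norm (C x) \<le> norm x)"

text \<open>The square root of \<open>I - C\<close> is \<open>I - Q\<close>, where \<open>Q\<close> solves \<open>Q = (C + Q\<^sup>2) / 2\<close> and is obtained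
  by iterating this equation from \<open>0\<close>.\<close>

primrec sqrt_iter :: "('a::complex_hilbert \<Rightarrow> 'a) \<Rightarrow> nat \<Rightarrow> 'a \<Rightarrow> 'a"
  where "sqrt_iter C 0 = (\<lambda>x. 0)"
  | "sqrt_iter C (Suc n) = (\<lambda>x. (1/2) *\<^sub>R (C x + sqrt_iter C n (sqrt_iter C n x)))"

text \<open>The same iteration for the scalar \<open>C = 1\<close>; it majorises the operator iteration in norm.\<close>

primrec sqrt_bound :: "nat \<Rightarrow> real"
  where "sqrt_bound 0 = 0"
  | "sqrt_bound (Suc n) = (1 + (sqrt_bound n)\<^sup>2) / 2"

lemma sqrt_bound_range: "0 \<le> sqrt_bound n" "sqrt_bound n \<le> 1"
proof -
  have "0 \<le> sqrt_bound n \<and> sqrt_bound n \<le> 1"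
    by (induction n) (auto simp: power_le_one)
  then show "0 \<le> sqrt_bound n" "sqrt_bound n \<le> 1" by auto
qed

lemma incseq_sqrt_bound: "incseq sqrt_bound"
proof (rule incseq_SucI)
  fix n
  have "0 \<le> (1 - sqrt_bound n)\<^sup>2" by simp
  then show "sqrt_bound n \<le> sqrt_bound (Suc n)" by (simp add: power2_eq_square algebra_simps)
qed

text \<open>The two claims share one induction because the norm estimate for the next iterate is
  also what makes it a bounded operator.\<close>

lemma sqrt_iter_props:
  assumes M: "closed_csubspace M" and C: "symmetric_contraction M C"
  shows "adjoint_on M M (sqrt_iter C n) (sqrt_iter C n)"
    "x \<in> M \<Longrightarrow> norm (sqrt_iter C n x) \<le> sqrt_bound n * norm x"
proof -
  have "adjoint_on M M (sqrt_iter C n) (sqrt_iter C n) \<and>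
    (\<forall>x\<in>M. norm (sqrt_iter C n x) \<le> sqrt_bound n * norm x)"
  proof (induction n)
    case 0
    then show ?case
      using closed_csubspaceD(4)[OF M] by (auto simp: adjoint_on_def bounded_op_def intro: exI[of _ 0])
  next
    case (Suc n)
    let ?E = "sqrt_iter C n" and ?p = "sqrt_bound n"
    have Cc: "adjoint_on M M C C" "\<And>x. x \<in> M \<Longrightarrow> norm (C x) \<le> norm x"
      using C by (auto simp: symmetric_contraction_def)
    note c = bounded_opD[OF adjoint_onD(1)[OF Cc(1)]]
    note e = bounded_opD[OF adjoint_onD(1)[OF conjunct1[OF Suc]]]
    have norm: "norm (sqrt_iter C (Suc n) x) \<le> sqrt_bound (Suc n) * norm x" if "x \<in> M" for x
    proof -
      have "norm (?E (?E x)) \<le> ?p * norm (?E x)" using Suc e(1)[OF that] by simp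
      also have "\<dots> \<le> ?p * (?p * norm x)"
        using Suc that sqrt_bound_range(1) by (intro mult_left_mono) auto
      finally have "norm (C x + ?E (?E x)) \<le> norm x + ?p * (?p * norm x)"
        using Cc(2)[OF that] norm_triangle_mono by blast
      then show ?thesis
        unfolding sqrt_iter.simps sqrt_bound.simps norm_scaleR
        by (simp add: power2_eq_square mult.assoc distrib_right)
    qed
    have "bounded_op M M (sqrt_iter C (Suc n))"
      unfolding bounded_op_def
    proof (intro conjI ballI allI)
      show "\<exists>k. \<forall>x\<in>M. norm (sqrt_iter C (Suc n) x) \<le> k * norm x" using norm by blast
    qed (simp_all add: c e closed_csubspaceD[OF M] scaleC_add_right scaleC_scaleR algebra_simps)
    moreover have "sqrt_iter C (Suc n) x \<bullet> y = x \<bullet> sqrt_iter C (Suc n) y" if "x \<in> M" "y \<in> M" for x y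
      using adjoint_onD(3)[OF Cc(1) that] adjoint_onD(3)[OF conjunct1[OF Suc]] that e(1)
      by (simp add: inner_add_left inner_add_right)
    ultimately show ?case using norm by (auto simp: adjoint_on_def simp del: sqrt_iter.simps sqrt_bound.simps)
  qed
  then show "adjoint_on M M (sqrt_iter C n) (sqrt_iter C n)"
    "x \<in> M \<Longrightarrow> norm (sqrt_iter C n x) \<le> sqrt_bound n * norm x" by auto
qed

text \<open>Each iterate is a polynomial in \<open>C\<close> without constant term, so
  \<open>V C = C' V\<close> carries over to it.\<close>

lemma sqrt_iter_natural:
  assumes N: "closed_csubspace N" and C: "symmetric_contraction N C"
    and V: "bounded_op N M V" and VC: "\<And>x. x \<in> N \<Longrightarrow> V (C x) = C' (V x)" and x: "x \<in> N"
  shows "V (sqrt_iter C n x) = sqrt_iter C' n (V x)"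
  using x
proof (induction n arbitrary: x)
  case 0
  then show ?case using bounded_opD'(1)[OF V N] by simp
next
  case (Suc n)
  note v = bounded_opD[OF V]
  note e = bounded_opD(1)[OF adjoint_onD(1)[OF sqrt_iter_props(1)[OF N C]]]
  have Cx: "C x \<in> N"
    using C Suc.prems bounded_opD(1) by (auto simp: symmetric_contraction_def adjoint_on_def)
  show ?case
    using Suc.prems Cx e[of _ n] by (simp add: v(2,4) closed_csubspaceD(5)[OF N] VC Suc.IH)
qed

lemma sqrt_iter_commute:
  assumes M: "closed_csubspace M" and C: "symmetric_contraction M C" and x: "x \<in> M"
  shows "sqrt_iter C m (sqrt_iter C n x) = sqrt_iter C n (sqrt_iter C m x)"
proof (rule sqrt_iter_natural[OF M C adjoint_onD(1)[OF sqrt_iter_props(1)[OF M C]] _ x])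
  have "bounded_op M M C" using C by (simp add: symmetric_contraction_def adjoint_on_def)
  then show "sqrt_iter C m (C y) = C (sqrt_iter C m y)" if "y \<in> M" for y
    using sqrt_iter_natural[OF M C, of M C C y] that by simp
qed

text \<open>For successive iterates E, F commutation gives F^2 - E^2 = (F + E)(F - E). The scalar
  iteration factors in the same way, so its increments dominate those of the operators.\<close>

lemma sqrt_iter_step:
  assumes M: "closed_csubspace M" and C: "symmetric_contraction M C" and x: "x \<in> M"
  shows "norm (sqrt_iter C (Suc n) x - sqrt_iter C n x) \<le> (sqrt_bound (Suc n) - sqrt_bound n) * norm x"
  using x
proof (induction n arbitrary: x)
  case 0
  then show ?case using C by (simp add: symmetric_contraction_def)
next
  case (Suc n)
  note x = Suc.prems
  note b = adjoint_onD(1)[OF sqrt_iter_props(1)[OF M C]]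
  let ?F = "sqrt_iter C (Suc n)" and ?E = "sqrt_iter C n"
  let ?f = "sqrt_bound (Suc n)" and ?e = "sqrt_bound n"
  have mem: "?F x \<in> M" "?E x \<in> M" "?F x - ?E x \<in> M"
    using bounded_opD(1)[OF b x] closed_csubspaceD(6)[OF M] by blast+
  have *: "?F (?F x - ?E x) + ?E (?F x - ?E x) = ?F (?F x) - ?E (?E x)"
    using sqrt_iter_commute[OF M C x, of "Suc n" n] mem bounded_opD'(3)[OF b M]
    by (simp del: sqrt_iter.simps)
  have "norm (?F (?F x - ?E x) + ?E (?F x - ?E x)) \<le> ?f * norm (?F x - ?E x) + ?e * norm (?F x - ?E x)"
    by (intro norm_triangle_mono sqrt_iter_props(2)[OF M C mem(3)])
  also have "\<dots> = (?f + ?e) * norm (?F x - ?E x)" by (simp add: algebra_simps)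
  also have "\<dots> \<le> (?f + ?e) * ((?f - ?e) * norm x)"
    by (intro mult_left_mono Suc.IH[OF x] add_nonneg_nonneg sqrt_bound_range)
  finally have "norm (?F (?F x) - ?E (?E x)) \<le> (?f\<^sup>2 - ?e\<^sup>2) * norm x"
    unfolding * by (simp add: power2_eq_square algebra_simps del: sqrt_iter.simps sqrt_bound.simps)
  moreover have "sqrt_iter C (Suc (Suc n)) x - ?F x = (1/2) *\<^sub>R (?F (?F x) - ?E (?E x))"
    by (subst (1 2) sqrt_iter.simps(2)) (simp add: scaleR_add_right scaleR_diff_right del: sqrt_iter.simps)
  moreover have "sqrt_bound (Suc (Suc n)) - ?f = (1/2) * (?f\<^sup>2 - ?e\<^sup>2)"
    by (subst (1 2) sqrt_bound.simps(2)) (simp add: field_simps del: sqrt_bound.simps)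
  ultimately show ?case by (simp only: norm_scaleR mult.assoc)
qed

definition sqrt_limit :: "('a::complex_hilbert \<Rightarrow> 'a) \<Rightarrow> 'a \<Rightarrow> 'a"
  where "sqrt_limit C x = lim (\<lambda>n. sqrt_iter C n x)"

lemma sqrt_iter_tendsto:
  assumes M: "closed_csubspace M" and C: "symmetric_contraction M C" and x: "x \<in> M"
  shows "(\<lambda>n. sqrt_iter C n x) \<longlonglongrightarrow> sqrt_limit C x"
proof -
  \<comment> \<open>The increment bounds telescope, so the Cauchy property is inherited from the
    bounded increasing sequence \<open>sqrt_bound\<close>.\<close>
  have step: "norm (sqrt_iter C (m + k) x - sqrt_iter C m x) \<le> (sqrt_bound (m + k) - sqrt_bound m) * norm x" for m k
  proof (induction k)
    case (Suc k)
    have "norm (sqrt_iter C (m + Suc k) x - sqrt_iter C m x)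
      = norm ((sqrt_iter C (Suc (m + k)) x - sqrt_iter C (m + k) x) + (sqrt_iter C (m + k) x - sqrt_iter C m x))"
      by (simp del: sqrt_iter.simps)
    also have "\<dots> \<le> (sqrt_bound (Suc (m + k)) - sqrt_bound (m + k)) * norm x
        + (sqrt_bound (m + k) - sqrt_bound m) * norm x"
      by (intro norm_triangle_mono Suc.IH sqrt_iter_step[OF M C x])
    finally show ?case by (simp add: algebra_simps del: sqrt_bound.simps)
  qed simp
  have "convergent sqrt_bound"
    using sqrt_bound_range
    by (intro Bseq_mono_convergent BseqI'[of _ 1]) (auto intro: incseqD[OF incseq_sqrt_bound])
  then have "Cauchy (\<lambda>n. sqrt_bound n * norm x)"
    by (intro convergent_Cauchy convergent_mult convergent_const)
  then have cau: "\<exists>N. \<forall>m\<ge>N. \<forall>n\<ge>N. norm (sqrt_bound m * norm x - sqrt_bound n * norm x) < e"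
    if "e > 0" for e
    using CauchyD that by blast
  have "Cauchy (\<lambda>n. sqrt_iter C n x)"
  proof (rule CauchyI')
    fix e :: real assume "e > 0"
    then obtain N where N: "\<And>m n. m \<ge> N \<Longrightarrow> n \<ge> N \<Longrightarrow> norm (sqrt_bound m * norm x - sqrt_bound n * norm x) < e"
      using cau by blast
    have "norm (sqrt_iter C m x - sqrt_iter C n x) < e" if "m \<ge> N" "n > m" for m n
    proof -
      have "norm (sqrt_iter C n x - sqrt_iter C m x) \<le> sqrt_bound n * norm x - sqrt_bound m * norm x"
        using step[of m "n - m"] that by (simp add: algebra_simps)
      also have "\<dots> < e" using N[of n m] that by simp
      finally show ?thesis by (simp add: norm_minus_commute)
    qed
    then show "\<exists>N. \<forall>m\<ge>N. \<forall>n>m. dist (sqrt_iter C m x) (sqrt_iter C n x) < e"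
      unfolding dist_norm by blast
  qed
  then show ?thesis
    unfolding sqrt_limit_def by (simp add: Cauchy_convergent convergent_LIMSEQ_iff[symmetric])
qed

lemma sqrt_limit_props:
  assumes M: "closed_csubspace M" and C: "symmetric_contraction M C"
  shows "adjoint_on M M (sqrt_limit C) (sqrt_limit C)"
    and "x \<in> M \<Longrightarrow> norm (sqrt_limit C x) \<le> norm x"
    and "x \<in> M \<Longrightarrow> 2 *\<^sub>R sqrt_limit C x = C x + sqrt_limit C (sqrt_limit C x)"
proof -
  let ?Q = "sqrt_limit C"
  note lim = sqrt_iter_tendsto[OF M C]
  note b = adjoint_onD(1)[OF sqrt_iter_props(1)[OF M C]]
  note c = closed_csubspaceD[OF M]
  have mem: "?Q x \<in> M" if "x \<in> M" for x
    by (rule closed_sequentially[OF c(2) bounded_opD(1)[OF b that] lim[OF that]])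
  have norm': "norm (sqrt_iter C n x) \<le> norm x" if "x \<in> M" for x n
    using sqrt_iter_props(2)[OF M C that, of n] mult_right_mono[OF sqrt_bound_range(2), of "norm x" n] by simp
  have norm: "norm (?Q x) \<le> norm x" if "x \<in> M" for x
    by (rule LIMSEQ_le_const2[OF tendsto_norm[OF lim[OF that]]]) (use norm' that in blast)
  have add: "?Q (x + y) = ?Q x + ?Q y" if "x \<in> M" "y \<in> M" for x y
    by (rule LIMSEQ_unique[OF lim[OF c(5)[OF that]]])
      (simp add: bounded_opD(2)[OF b that] tendsto_add lim that)
  have scale: "?Q (k *\<^sub>C x) = k *\<^sub>C ?Q x" if "x \<in> M" for x k
  proof (rule LIMSEQ_unique[OF lim[OF c(3)[OF that]]])
    have "(\<lambda>n. k *\<^sub>C sqrt_iter C n x) \<longlonglongrightarrow> k *\<^sub>C ?Q x"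
      using continuous_on_tendsto_compose[OF continuous_on_scaleC[of UNIV k] lim[OF that]] by simp
    then show "(\<lambda>n. sqrt_iter C n (k *\<^sub>C x)) \<longlonglongrightarrow> k *\<^sub>C ?Q x"
      by (simp add: bounded_opD(3)[OF b that])
  qed
  have sym: "?Q x \<bullet> y = x \<bullet> ?Q y" if "x \<in> M" "y \<in> M" for x y
  proof (rule LIMSEQ_unique)
    show "(\<lambda>n. sqrt_iter C n x \<bullet> y) \<longlonglongrightarrow> ?Q x \<bullet> y" by (intro tendsto_intros lim that)
    have "(\<lambda>n. x \<bullet> sqrt_iter C n y) \<longlonglongrightarrow> x \<bullet> ?Q y" by (intro tendsto_intros lim that)
    then show "(\<lambda>n. sqrt_iter C n x \<bullet> y) \<longlonglongrightarrow> x \<bullet> ?Q y"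
      by (simp add: adjoint_onD(3)[OF sqrt_iter_props(1)[OF M C] that])
  qed
  have "bounded_op M M ?Q"
    unfolding bounded_op_def using mem add scale norm by (auto intro!: exI[of _ 1])
  then show "adjoint_on M M ?Q ?Q" using sym unfolding adjoint_on_def by blast
  show "norm (?Q x) \<le> norm x" if "x \<in> M" using norm[OF that] .
  show "2 *\<^sub>R ?Q x = C x + ?Q (?Q x)" if x: "x \<in> M"
  proof (rule LIMSEQ_unique)
    show "(\<lambda>n. 2 *\<^sub>R sqrt_iter C (Suc n) x) \<longlonglongrightarrow> 2 *\<^sub>R ?Q x"
      by (intro tendsto_intros LIMSEQ_Suc lim x)
    \<comment> \<open>Both factors vary with n; splitting off E_n (E_n x - Q x), where E_n is the
      n-th iterate, works because all iterates have norm at most 1.\<close>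
    have "(\<lambda>n. sqrt_iter C n (sqrt_iter C n x) - ?Q (?Q x)) \<longlonglongrightarrow> 0"
    proof (rule Lim_null_comparison)
      show "\<forall>\<^sub>F n in sequentially. norm (sqrt_iter C n (sqrt_iter C n x) - ?Q (?Q x))
        \<le> norm (sqrt_iter C n x - ?Q x) + norm (sqrt_iter C n (?Q x) - ?Q (?Q x))"
      proof (intro always_eventually allI)
        fix n
        have m: "sqrt_iter C n x \<in> M" using bounded_opD(1)[OF b x] .
        have "sqrt_iter C n (sqrt_iter C n x) - ?Q (?Q x) =
          sqrt_iter C n (sqrt_iter C n x - ?Q x) + (sqrt_iter C n (?Q x) - ?Q (?Q x))"
          by (simp add: bounded_opD'(3)[OF b M m mem[OF x]])
        then show "norm (sqrt_iter C n (sqrt_iter C n x) - ?Q (?Q x))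
          \<le> norm (sqrt_iter C n x - ?Q x) + norm (sqrt_iter C n (?Q x) - ?Q (?Q x))"
          using norm'[OF c(6)[OF m mem[OF x]], of n] by (metis norm_triangle_mono order_refl)
      qed
      have "(\<lambda>n. norm (sqrt_iter C n x - ?Q x) + norm (sqrt_iter C n (?Q x) - ?Q (?Q x))) \<longlonglongrightarrow> 0 + 0"
        by (intro tendsto_add tendsto_norm_zero LIM_zero lim x mem)
      then show "(\<lambda>n. norm (sqrt_iter C n x - ?Q x) + norm (sqrt_iter C n (?Q x) - ?Q (?Q x))) \<longlonglongrightarrow> 0"
        by simp
    qed
    then have "(\<lambda>n. C x + sqrt_iter C n (sqrt_iter C n x)) \<longlonglongrightarrow> C x + ?Q (?Q x)"
      by (intro tendsto_intros) (rule LIM_zero_cancel)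
    then show "(\<lambda>n. 2 *\<^sub>R sqrt_iter C (Suc n) x) \<longlonglongrightarrow> C x + ?Q (?Q x)" by simp
  qed
qed

text \<open>The limit form of \<open>sqrt_iter_natural\<close>. It yields both the intertwining of
  the defect operators and the commutation behind uniqueness of the root.\<close>

lemma sqrt_limit_natural:
  assumes N: "closed_csubspace N" and C: "symmetric_contraction N C"
    and M: "closed_csubspace M" and C': "symmetric_contraction M C'"
    and V: "bounded_op N M V" and VC: "\<And>x. x \<in> N \<Longrightarrow> V (C x) = C' (V x)" and x: "x \<in> N"
  shows "V (sqrt_limit C x) = sqrt_limit C' (V x)"
proof (rule LIMSEQ_unique)
  have "(\<lambda>n. V (sqrt_iter C n x)) \<longlonglongrightarrow> V (sqrt_limit C x)"
    by (intro continuous_on_tendsto_compose[OF bounded_op_continuous_on[OF V N] sqrt_iter_tendsto[OF N C x]]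
        always_eventually allI bounded_opD(1)[OF adjoint_onD(1)[OF sqrt_limit_props(1)[OF N C]] x]
        bounded_opD(1)[OF adjoint_onD(1)[OF sqrt_iter_props(1)[OF N C]] x])
  then show "(\<lambda>n. sqrt_iter C' n (V x)) \<longlonglongrightarrow> V (sqrt_limit C x)"
    by (simp add: sqrt_iter_natural[OF N C V VC x])
  show "(\<lambda>n. sqrt_iter C' n (V x)) \<longlonglongrightarrow> sqrt_limit C' (V x)"
    by (rule sqrt_iter_tendsto[OF M C' bounded_opD(1)[OF V x]])
qed

section \<open>Positive operators and identification of the selected square root\<close>

text \<open>On a complex space a real quadratic form forces symmetry: polarise the vanishing
  imaginary part, then replace y by \<open>\<i> *\<^sub>C y\<close>.\<close>

lemma positive_op_iff:
  assumes M: "closed_csubspace M"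
  shows "positive_op M A \<longleftrightarrow> adjoint_on M M A A \<and> (\<forall>x\<in>M. 0 \<le> A x \<bullet> x)"
proof
  assume pos: "positive_op M A"
  then have A: "bounded_op M M A" and im: "\<And>x. x \<in> M \<Longrightarrow> Im (cinner (A x) x) = 0"
    and nn: "\<And>x. x \<in> M \<Longrightarrow> 0 \<le> A x \<bullet> x"
    unfolding positive_op_def Re_cinner by auto
  note a = bounded_opD[OF A] and c = closed_csubspaceD[OF M]
  have q: "(\<i> *\<^sub>C A x) \<bullet> x = 0" if "x \<in> M" for x
    using im[OF that] by (simp add: cinner_eq_inner)
  have pol: "(\<i> *\<^sub>C A x) \<bullet> y + (\<i> *\<^sub>C A y) \<bullet> x = 0" if "x \<in> M" "y \<in> M" for x y
    using q[OF c(5)[OF that]] q[OF that(1)] q[OF that(2)] that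
    by (simp add: a(2) scaleC_add_right inner_add_left inner_add_right)
  have "A x \<bullet> y = x \<bullet> A y" if "x \<in> M" "y \<in> M" for x y
  proof -
    have ii: "\<i> *\<^sub>C \<i> *\<^sub>C z = - z" for z :: 'a
      using scaleC_of_real[of "-1" z] by (simp add: scaleC_scaleC)
    have "(\<i> *\<^sub>C A x) \<bullet> (\<i> *\<^sub>C y) = A x \<bullet> y"
      by (simp add: inner_imaginary_unit_swap ii)
    moreover have "(\<i> *\<^sub>C A (\<i> *\<^sub>C y)) \<bullet> x = - (A y \<bullet> x)"
      using that by (simp add: a(3) ii)
    ultimately show ?thesis
      using pol[OF that(1) c(3)[OF that(2), of \<i>]] by (simp add: inner_commute)
  qed
  then show "adjoint_on M M A A \<and> (\<forall>x\<in>M. 0 \<le> A x \<bullet> x)"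
    using A nn unfolding adjoint_on_def by blast
next
  assume A: "adjoint_on M M A A \<and> (\<forall>x\<in>M. 0 \<le> A x \<bullet> x)"
  note b = adjoint_onD(1)[OF conjunct1[OF A]]
  have "Im (cinner (A x) x) = 0" if "x \<in> M" for x
  proof -
    have "(\<i> *\<^sub>C A x) \<bullet> x = (\<i> *\<^sub>C x) \<bullet> A x"
      using adjoint_onD(3)[OF conjunct1[OF A] closed_csubspaceD(3)[OF M that] that, of \<i>]
      by (simp add: bounded_opD(3)[OF b that])
    then show ?thesis
      by (simp add: cinner_eq_inner inner_imaginary_unit_swap[of x]) (metis add.inverse_neutral inner_commute neg_equal_zero)
  qed
  then show "positive_op M A" using A b unfolding positive_op_def Re_cinner by blast
qed

text \<open>The form of \<open>B\<close> at y - t (B y) has first-order term - 2 t |B y|^2, so it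
  would become negative for small t > 0 if B y were nonzero.\<close>

lemma positive_op_null:
  assumes M: "closed_csubspace M" and B: "positive_op M B" and y: "y \<in> M" and zero: "B y \<bullet> y = 0"
  shows "B y = 0"
proof -
  have adj: "adjoint_on M M B B" and nn: "\<And>x. x \<in> M \<Longrightarrow> 0 \<le> B x \<bullet> x"
    using B positive_op_iff[OF M] by auto
  note b = bounded_opD[OF adjoint_onD(1)[OF adj]] and c = closed_csubspaceD[OF M]
  let ?z = "B y"
  \<comment> \<open>The summand 1 makes s positive; with t = q / s, i.e. q = t s, the form collapses
    to - t^2 (s + 1).\<close>
  define s where "s = B ?z \<bullet> ?z + 1"
  have zM: "?z \<in> M" using b(1) y .
  have s: "s > 0" using nn[OF zM] unfolding s_def by linarith
  define q where "q = ?z \<bullet> ?z"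
  have q: "q \<ge> 0" unfolding q_def by simp
  define t where "t = q / s"
  have tM: "t *\<^sub>R ?z \<in> M" by (rule c(8)[OF zM])
  have eq: "B (y - t *\<^sub>R ?z) = ?z - t *\<^sub>R B ?z"
    using bounded_opD'(3)[OF adjoint_onD(1)[OF adj] M y tM] b(4)[OF zM] by simp
  have "0 \<le> B (y - t *\<^sub>R ?z) \<bullet> (y - t *\<^sub>R ?z)"
    by (rule nn[OF c(6)[OF y tM]])
  also have "\<dots> = ?z \<bullet> y - t * (?z \<bullet> ?z) - t * (B ?z \<bullet> y) + t * t * (B ?z \<bullet> ?z)"
    unfolding eq by (simp add: inner_diff_left inner_diff_right algebra_simps)
  also have "\<dots> = t * t * (s - 1) - 2 * t * q"
    using zero adjoint_onD(3)[OF adj zM y] by (simp add: q_def s_def)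
  also have "\<dots> = - (t * t * (s + 1))"
    using s by (simp add: t_def field_simps)
  finally have "t * t * (s + 1) \<le> 0" by simp
  then have "t * t \<le> 0" using s by (simp add: mult_le_0_iff)
  then have "t = 0" by (metis antisym mult_eq_0_iff zero_le_square)
  then show ?thesis using s by (simp add: t_def q_def)
qed

text \<open>With y = B x - B' x, commutation gives (B + B') y = B^2 x - B'^2 x = 0. Both nonnegative
  forms then vanish at y, hence B y = B' y = 0, and |y|^2 = 0 by symmetry.\<close>

lemma positive_sqrt_unique:
  assumes M: "closed_csubspace M" and B: "positive_op M B" and B': "positive_op M B'"
    and comm: "\<And>x. x \<in> M \<Longrightarrow> B (B' x) = B' (B x)"
    and sq: "\<And>x. x \<in> M \<Longrightarrow> B (B x) = B' (B' x)" and x: "x \<in> M"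
  shows "B x = B' x"
proof -
  have adj: "adjoint_on M M B B" "adjoint_on M M B' B'"
    and nn: "\<And>x. x \<in> M \<Longrightarrow> 0 \<le> B x \<bullet> x" "\<And>x. x \<in> M \<Longrightarrow> 0 \<le> B' x \<bullet> x"
    using B B' positive_op_iff[OF M] by auto
  note b = adjoint_onD(1)[OF adj(1)] and b' = adjoint_onD(1)[OF adj(2)] and c = closed_csubspaceD[OF M]
  have m: "B x \<in> M" "B' x \<in> M" using bounded_opD(1)[OF b x] bounded_opD(1)[OF b' x] by auto
  define y where "y = B x - B' x"
  have y: "y \<in> M" unfolding y_def by (intro c m)
  have "B y + B' y = 0"
    unfolding y_def using bounded_opD'(3)[OF b M m] bounded_opD'(3)[OF b' M m] comm[OF x] sq[OF x] by simp
  then have "B y \<bullet> y + B' y \<bullet> y = 0" by (metis inner_add_left inner_zero_left)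
  then have z: "B y \<bullet> y = 0" "B' y \<bullet> y = 0" using nn[OF y] by linarith+
  have "B y = 0" "B' y = 0" using positive_op_null[OF M] B B' y z by blast+
  then have "B x \<bullet> y - B' x \<bullet> y = 0"
    using adjoint_onD(3)[OF adj(1) x y] adjoint_onD(3)[OF adj(2) x y] by simp
  then have "y \<bullet> y = 0" unfolding y_def inner_diff_left .
  then show ?thesis by (simp add: y_def)
qed

text \<open>The witness I - Q makes the selection meaningful. Any selected root commutes with its
  square A, hence with C = I - A, hence by naturality with Q; uniqueness among commuting roots then
  equates it with I - Q.\<close>

lemma sqrt_op_symmetric_contraction:
  assumes M: "closed_csubspace M" and C: "symmetric_contraction M C"
    and A: "\<And>x. x \<in> M \<Longrightarrow> A x = x - C x"
  shows "positive_op M (sqrt_op M A)"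
    and "x \<in> M \<Longrightarrow> sqrt_op M A (sqrt_op M A x) = A x"
    and "x \<in> M \<Longrightarrow> sqrt_op M A x = x - sqrt_limit C x"
proof -
  let ?Q = "sqrt_limit C" and ?B = "sqrt_op M A"
  note Q = sqrt_limit_props[OF M C]
  have bC: "bounded_op M M C" using C by (simp add: symmetric_contraction_def adjoint_on_def)
  have bQ: "bounded_op M M ?Q" using adjoint_onD(1)[OF Q(1)] .
  have mQ: "?Q x \<in> M" if "x \<in> M" for x using bounded_opD(1)[OF bQ that] .
  define R where "R x = x - ?Q x" for x
  have bR: "bounded_op M M R" unfolding R_def by (rule bounded_op_diff_id[OF bQ M])
  have "adjoint_on M M R R"
    using bR adjoint_onD(3)[OF Q(1)] unfolding adjoint_on_def
    by (simp add: R_def inner_diff_left inner_diff_right)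
  moreover have "0 \<le> R x \<bullet> x" if "x \<in> M" for x
  proof -
    have "?Q x \<bullet> x \<le> norm (?Q x) * norm x" by (rule norm_cauchy_schwarz)
    also have "\<dots> \<le> norm x * norm x" using Q(2)[OF that] by (intro mult_right_mono) auto
    finally show ?thesis
      by (simp add: R_def inner_diff_left power2_norm_eq_inner[symmetric] power2_eq_square)
  qed
  ultimately have posR: "positive_op M R" using positive_op_iff[OF M] by blast
  have sqR: "R (R x) = A x" if x: "x \<in> M" for x
  proof -
    have "R (R x) = x - 2 *\<^sub>R ?Q x + ?Q (?Q x)"
      unfolding R_def bounded_opD'(3)[OF bQ M x mQ[OF x]] by (simp add: scaleR_2)
    then show ?thesis unfolding Q(3)[OF x] A[OF x] by simp
  qed
  have "positive_op M ?B \<and> (\<forall>x\<in>M. ?B (?B x) = A x)"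
    unfolding sqrt_op_def by (rule someI[where x = R]) (use posR sqR in blast)
  then have posB: "positive_op M ?B" and sqB: "\<And>x. x \<in> M \<Longrightarrow> ?B (?B x) = A x" by auto
  then show "positive_op M ?B" "x \<in> M \<Longrightarrow> ?B (?B x) = A x" by auto
  have bB: "bounded_op M M ?B" using posB by (simp add: positive_op_def)
  have mB: "?B x \<in> M" if "x \<in> M" for x using bounded_opD(1)[OF bB that] .
  have BC: "?B (C x) = C (?B x)" if "x \<in> M" for x
  proof -
    have "?B (A x) = A (?B x)" using sqB[OF that] sqB[OF mB[OF that]] by simp
    then show ?thesis
      using A that mB[OF that] bounded_opD'(3)[OF bB M that bounded_opD(1)[OF bC that]] by simp
  qed
  have BR: "?B (R x) = R (?B x)" if "x \<in> M" for x
    unfolding R_def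
    using sqrt_limit_natural[OF M C M C bB BC that] bounded_opD'(3)[OF bB M that mQ[OF that]] by simp
  show "?B x = x - ?Q x" if "x \<in> M"
    using positive_sqrt_unique[OF M posB posR BR _ that] sqB sqR by (simp add: R_def)
qed

lemma symmetric_contraction_compose:
  assumes "adjoint_on M N X X'" and "\<forall>x\<in>M. norm (X x) \<le> norm x"
  shows "\<forall>y\<in>N. norm (X' y) \<le> norm y"
    and "symmetric_contraction M (\<lambda>x. X' (X x))" "symmetric_contraction N (\<lambda>y. X (X' y))"
proof -
  have X: "X x \<in> N" if "x \<in> M" for x using bounded_opD(1)[OF adjoint_onD(1)[OF assms(1)] that] .
  have X': "X' y \<in> M" if "y \<in> N" for y using bounded_opD(1)[OF adjoint_onD(2)[OF assms(1)] that] .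
  have le: "norm (X' y) \<le> norm y" if "y \<in> N" for y
  proof -
    have "norm (X' y) * norm (X' y) = X (X' y) \<bullet> y"
      using adjoint_onD(3)[OF assms(1) X'[OF that] that]
      by (simp add: power2_norm_eq_inner[symmetric] power2_eq_square)
    also have "\<dots> \<le> norm (X (X' y)) * norm y" by (rule norm_cauchy_schwarz)
    also have "\<dots> \<le> norm (X' y) * norm y" using assms(2) X'[OF that] by (intro mult_right_mono) auto
    finally show ?thesis by (cases "norm (X' y) = 0") (auto simp: mult_le_cancel_left)
  qed
  then show "\<forall>y\<in>N. norm (X' y) \<le> norm y" by blast
  show "symmetric_contraction M (\<lambda>x. X' (X x))" "symmetric_contraction N (\<lambda>y. X (X' y))"
    unfolding symmetric_contraction_def
    using adjoint_on_compose[OF assms(1) adjoint_on_sym[OF assms(1)]]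
      adjoint_on_compose[OF adjoint_on_sym[OF assms(1)] assms(1)] le assms(2) X X'
    by (meson order_trans)+
qed

text \<open>By associativity \<open>X'\<close> intertwines X X' with X' X, so
  \<open>sqrt_limit_natural\<close> applies, and both roots have the form I - Q.\<close>

lemma defect_intertwine:
  assumes M: "closed_csubspace M" and N: "closed_csubspace N"
    and X: "adjoint_on M N X X'" and le: "\<forall>x\<in>M. norm (X x) \<le> norm x"
    and A: "\<And>x. x \<in> M \<Longrightarrow> A x = x - X' (X x)" and A': "\<And>y. y \<in> N \<Longrightarrow> A' y = y - X (X' y)"
    and y: "y \<in> N"
  shows "X' (sqrt_op N A' y) = sqrt_op M A (X' y)"
proof -
  note sc = symmetric_contraction_compose(2,3)[OF X le]
  note b' = adjoint_onD(2)[OF X]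
  have "sqrt_limit (\<lambda>y. X (X' y)) y \<in> N"
    using bounded_opD(1)[OF adjoint_onD(1)[OF sqrt_limit_props(1)[OF N sc(2)]] y] .
  then show ?thesis
    using sqrt_limit_natural[OF N sc(2) M sc(1) b' _ y] bounded_opD(1)[OF b' y]
    by (simp add: sqrt_op_symmetric_contraction(3)[OF M sc(1)] sqrt_op_symmetric_contraction(3)[OF N sc(2)]
        A A' y bounded_opD'(3)[OF b' N y])
qed

text \<open>Split x = v + w with v in the closure of ran B and w orthogonal to it. Then |B w|^2 = w
  . B (B w) = 0, so B x = B v, which is a limit of vectors B (B z).\<close>

lemma closure_range_square:
  assumes M: "closed_csubspace M" and B: "adjoint_on M M B B"
  shows "closure ((\<lambda>x. B (B x)) ` M) = closure (B ` M)"
proof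
  note b = adjoint_onD(1)[OF B]
  have m: "B x \<in> M" if "x \<in> M" for x using bounded_opD(1)[OF b that] .
  show "closure ((\<lambda>x. B (B x)) ` M) \<subseteq> closure (B ` M)"
    by (intro closure_mono) (use m in auto)
  have V: "closed_csubspace (closure (B ` M))" by (rule closed_csubspace_closure_image[OF b M])
  have VM: "closure (B ` M) \<subseteq> M"
    by (intro closure_minimal closed_csubspaceD[OF M]) (use m in auto)
  have "B x \<in> closure ((\<lambda>x. B (B x)) ` M)" if x: "x \<in> M" for x
  proof -
    obtain v w where vw: "x = v + w" "v \<in> closure (B ` M)" "\<forall>z\<in>closure (B ` M). w \<bullet> z = 0"
      by (rule orthogonal_split[OF V, where x = x])
    have vM: "v \<in> M" by (rule subsetD[OF VM vw(2)])
    have wM: "w \<in> M" using closed_csubspaceD(6)[OF M x vM] vw(1) by simp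
    have "B (B w) \<in> closure (B ` M)" by (intro subsetD[OF closure_subset] imageI m wM)
    then have "B w \<bullet> B w = 0" using adjoint_onD(3)[OF B wM m[OF wM]] vw(3) by simp
    then have "B x = B v" using bounded_opD(2)[OF b vM wM] vw(1) by simp
    moreover have "B v \<in> closure (B ` (B ` M))"
      by (rule bounded_op_closure_image[OF b M _ vw(2)]) (use m in auto)
    ultimately show ?thesis by (simp add: image_image)
  qed
  then show "closure (B ` M) \<subseteq> closure ((\<lambda>x. B (B x)) ` M)"
    by (intro closure_minimal closed_closure) auto
qed

subsection \<open>Triangular block operators\<close>

text \<open>The intertwining \<open>X\<^sup>* B = A^(1/2) X\<^sup>*\<close> for \<open>A = I - X\<^sup>* X\<close> identifies
  the operator \<open>A^(-1/2) (- X\<^sup>* B L)\<close> with \<open>- X\<^sup>* L\<close>.\<close>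

lemma defect_completion:
  assumes M: "closed_csubspace M" and N: "closed_csubspace N" and P: "closed_csubspace P"
    and X: "adjoint_on M N X X'" and le: "\<forall>x\<in>M. norm (X x) \<le> norm x"
    and B: "B = sqrt_op N (\<lambda>y. y - X (X' y))"
    and L: "adjoint_on P (closure (B ` N)) L L'"
    and A: "\<forall>x\<in>M. A x = x - X' (X x)"
    and A12: "\<forall>x\<in>P. A12 x = - X' (B (L x))"
    and Y: "Y = inv_sqrt_comp M A A12"
  shows "positive_op M A"
    and "A12 ` P \<subseteq> sqrt_op M A ` M"
    and "\<forall>x\<in>P. \<exists>!y. is_inv_sqrt M A (A12 x) y"
    and "bounded_op P M Y"
    and "\<And>x. x \<in> P \<Longrightarrow> adj P Y (Y x) = L' (L x) - L' (B (B (L x)))"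
proof -
  let ?D = "sqrt_op M A" and ?R = "closure (B ` N)"
  note sc = symmetric_contraction_compose(2,3)[OF X le]
  have D: "positive_op M ?D" "\<And>x. x \<in> M \<Longrightarrow> ?D (?D x) = A x"
    by (rule sqrt_op_symmetric_contraction[OF M sc(1)]; use A in simp)+
  have Bsq: "B (B y) = y - X (X' y)" if "y \<in> N" for y
    using sqrt_op_symmetric_contraction(2)[OF N sc(2) refl that] unfolding B .
  have Bpos: "positive_op N B"
    using sqrt_op_symmetric_contraction(1)[OF N sc(2) refl] unfolding B .
  have Badj: "adjoint_on N N B B" and Dadj: "adjoint_on M M ?D ?D"
    using Bpos D(1) positive_op_iff[OF N] positive_op_iff[OF M] by auto
  note bB = adjoint_onD(1)[OF Badj] and bD = adjoint_onD(1)[OF Dadj]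
  have inter: "X' (B y) = ?D (X' y)" if "y \<in> N" for y
    unfolding B by (rule defect_intertwine[OF M N X le _ refl that]) (use A in simp)
  have X'm: "X' y \<in> M" if "y \<in> N" for y using bounded_opD(1)[OF adjoint_onD(2)[OF X] that] .
  have RN: "?R \<subseteq> N"
    by (intro closure_minimal closed_csubspaceD[OF N]) (use bounded_opD(1)[OF bB] in auto)
  have R: "closed_csubspace ?R" by (rule closed_csubspace_closure_image[OF bB N])
  have Lm: "L x \<in> ?R" "L x \<in> N" if "x \<in> P" for x
    using bounded_opD(1)[OF adjoint_onD(1)[OF L] that] RN by auto
  have bA: "bounded_op M M A"
    by (rule bounded_op_cong[OF bounded_op_diff_id[OF _ M] M])
      (use sc(1) A in \<open>auto simp: symmetric_contraction_def adjoint_on_def\<close>)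
  have "A ` M = (\<lambda>x. ?D (?D x)) ` M" using D(2) by (auto simp: image_iff)
  then have RA: "closure (A ` M) = closure (?D ` M)"
    using closure_range_square[OF M Dadj] by simp
  have Am: "A x \<in> M" if "x \<in> M" for x using bounded_opD(1)[OF bA that] .
  have RAM: "closure (A ` M) \<subseteq> M"
    by (intro closure_minimal closed_csubspaceD[OF M]) (use Am in auto)
  \<comment> \<open>L x is only a limit of vectors B n. Continuity of X' and X' B = D X' place X' (L
    x) in the closure of ran D, which is the closure of ran A.\<close>
  have inv: "is_inv_sqrt M A (A12 x) (- X' (L x))" if x: "x \<in> P" for x
  proof -
    have "X' (L x) \<in> closure (X' ` (B ` N))"
      by (rule bounded_op_closure_image[OF adjoint_onD(2)[OF X] N _ Lm(1)[OF x]])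
        (use bounded_opD(1)[OF bB] in auto)
    also have "\<dots> \<subseteq> closure (?D ` M)"
      by (intro closure_mono) (use inter X'm in auto)
    finally have "X' (L x) \<in> closure (A ` M)" unfolding RA .
    then have "- X' (L x) \<in> closure (A ` M)"
      by (rule closed_csubspaceD(7)[OF closed_csubspace_closure_image[OF bA M]])
    moreover have "?D (- X' (L x)) = A12 x"
      using bounded_opD'(2)[OF bD M X'm[OF Lm(2)[OF x]]] inter[OF Lm(2)[OF x]] A12 x by simp
    ultimately show ?thesis unfolding is_inv_sqrt_def by simp
  qed
  have uniq: "y = z" if "is_inv_sqrt M A b y" "is_inv_sqrt M A b z" for b y z
  proof -
    have yz: "y \<in> closure (A ` M)" "z \<in> closure (A ` M)" "?D y = ?D z"
      using that unfolding is_inv_sqrt_def by auto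
    have V: "closed_csubspace (closure (A ` M))" by (rule closed_csubspace_closure_image[OF bA M])
    have m: "y \<in> M" "z \<in> M" using yz RAM by auto
    let ?d = "y - z"
    have d: "?d \<in> closure (A ` M)" "?d \<in> M"
      using closed_csubspaceD(6)[OF V yz(1,2)] closed_csubspaceD(6)[OF M m] by auto
    have Dd: "?D ?d = 0" using bounded_opD'(3)[OF bD M m] yz(3) by simp
    \<comment> \<open>D d = 0 makes d orthogonal to ran A = ran D^2; since d lies in the closure of
      ran A, it is orthogonal to itself.\<close>
    have "A ` M \<subseteq> {w. ?d \<bullet> w = 0}"
    proof clarify
      fix w assume w: "w \<in> M"
      have "?d \<bullet> A w = ?D ?d \<bullet> ?D w"
        using adjoint_onD(3)[OF Dadj d(2) bounded_opD(1)[OF bD w]] D(2)[OF w] by simp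
      then show "?d \<bullet> A w = 0" using Dd by simp
    qed
    then have "closure (A ` M) \<subseteq> {w. ?d \<bullet> w = 0}"
      by (rule closure_minimal) (rule closed_hyperplane)
    with d(1) have "?d \<bullet> ?d = 0" by blast
    then show ?thesis by simp
  qed
  have Yx: "Y x = - X' (L x)" if "x \<in> P" for x
    unfolding Y inv_sqrt_comp_def by (rule the_equality) (use inv[OF that] uniq in blast)+
  show "positive_op M A"
    unfolding positive_op_iff[OF M]
  proof (intro conjI ballI)
    show "adjoint_on M M A A"
      using bA adjoint_onD(3)[OF Dadj] D(2) bounded_opD(1)[OF bD] unfolding adjoint_on_def by metis
    show "0 \<le> A x \<bullet> x" if "x \<in> M" for x
      using adjoint_onD(3)[OF Dadj bounded_opD(1)[OF bD that] that] D(2)[OF that] by simp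
  qed
  show "A12 ` P \<subseteq> ?D ` M"
  proof clarify
    fix x assume x: "x \<in> P"
    have "- X' (L x) \<in> M" by (rule closed_csubspaceD(7)[OF M X'm[OF Lm(2)[OF x]]])
    moreover have "?D (- X' (L x)) = A12 x" using inv[OF x] unfolding is_inv_sqrt_def by simp
    ultimately show "A12 x \<in> ?D ` M" by (metis imageI)
  qed
  show "\<forall>x\<in>P. \<exists>!y. is_inv_sqrt M A (A12 x) y" using inv uniq by blast
  have LN: "bounded_op P N L" using adjoint_onD(1)[OF L] RN unfolding bounded_op_def by blast
  show bY: "bounded_op P M Y"
    by (rule bounded_op_cong[OF bounded_op_minus[OF bounded_op_compose[OF LN adjoint_onD(2)[OF X]] M] P])
      (simp add: Yx)
  show "adj P Y (Y x) = L' (L x) - L' (B (B (L x)))" if x: "x \<in> P" for x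
  proof -
    have BR: "B (B (L x)) \<in> ?R"
      by (intro subsetD[OF closure_subset] imageI bounded_opD(1)[OF bB Lm(2)[OF x]])
    \<comment> \<open>L' is an adjoint only on the closure of ran B. Writing X (X' (L x)) in this
      form shows that it lies there.\<close>
    let ?w = "L x - B (B (L x))"
    have w: "?w = X (X' (L x))" using Bsq[OF Lm(2)[OF x]] by simp
    have wR: "?w \<in> ?R" by (rule closed_csubspaceD(6)[OF R Lm(1)[OF x] BR])
    have "adj P Y (Y x) = L' ?w"
    proof (rule adj_eqI[OF P bounded_opD(3)[OF bY]])
      show "L' ?w \<in> P" by (rule bounded_opD(1)[OF adjoint_onD(2)[OF L] wR])
      fix z assume z: "z \<in> P"
      have "Y z \<bullet> Y x = X' (L z) \<bullet> X' (L x)" using Yx x z by simp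
      also have "\<dots> = L z \<bullet> ?w"
        using adjoint_onD(3)[OF adjoint_on_sym[OF X] Lm(2)[OF z] X'm[OF Lm(2)[OF x]]] w by simp
      also have "\<dots> = z \<bullet> L' ?w" by (rule adjoint_onD(3)[OF L z wR])
      finally show "Y z \<bullet> Y x = z \<bullet> L' ?w" .
    qed
    also have "\<dots> = L' (L x) - L' (B (B (L x)))"
      by (rule bounded_opD'(3)[OF adjoint_onD(2)[OF L] R Lm(1)[OF x] BR])
    finally show ?thesis .
  qed
qed

text \<open>The selecting predicate reads A only on M, so the two selections coincide as functions,
  even outside M.\<close>

lemma sqrt_op_cong:
  assumes "\<And>x. x \<in> M \<Longrightarrow> A x = A' x"
  shows "sqrt_op M A = sqrt_op M A'"
  unfolding sqrt_op_def using assms by simp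

text \<open>The third claim regards D as a map into the closure of its own range, with D restricted
  to that closure as adjoint; this is the form in which it composes with \<open>K\<close>.\<close>

lemma positive_sqrt_defect:
  assumes M: "closed_csubspace M" and C: "symmetric_contraction M C" and D: "D = sqrt_op M (\<lambda>x. x - C x)"
  shows "adjoint_on M M D D" "x \<in> M \<Longrightarrow> D (D x) = x - C x"
    "adjoint_on M (closure (D ` M)) D D" "closed_csubspace (closure (D ` M))" "closure (D ` M) \<subseteq> M"
proof -
  show a: "adjoint_on M M D D"
    using sqrt_op_symmetric_contraction(1)[OF M C refl] positive_op_iff[OF M] unfolding D by blast
  show "x \<in> M \<Longrightarrow> D (D x) = x - C x"
    using sqrt_op_symmetric_contraction(2)[OF M C refl] unfolding D .
  note b = adjoint_onD(1)[OF a]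
  show "closed_csubspace (closure (D ` M))" by (rule closed_csubspace_closure_image[OF b M])
  show sub: "closure (D ` M) \<subseteq> M"
    by (intro closure_minimal closed_csubspaceD[OF M]) (use bounded_opD(1)[OF b] in auto)
  have "D x \<in> closure (D ` M)" if "x \<in> M" for x by (intro subsetD[OF closure_subset] imageI that)
  then show "adjoint_on M (closure (D ` M)) D D"
    using a sub unfolding adjoint_on_def bounded_op_def by blast
qed

text \<open>The candidate is the lower triangular matrix of adjoint entries; pairing it with u + v
  leaves only cross terms that vanish by orthogonality of the components.\<close>

lemma adj_block_upper_triangular:
  assumes dec: "orth_decomp H1 H2" and dec': "orth_decomp H1' H2'"
    and T1: "adjoint_on H1 H1' T11 T1" and E: "adjoint_on H2 H1' E E'" and T2: "adjoint_on H2 H2' T22 T2"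
    and T: "T = block_op H1 H2 T11 E (\<lambda>x. 0) T22"
  shows "x \<in> H1 \<Longrightarrow> y \<in> H2 \<Longrightarrow> T (x + y) = (T11 x + E y) + T22 y"
    and "x \<in> H1' \<Longrightarrow> y \<in> H2' \<Longrightarrow> adj UNIV T (x + y) = T1 x + (E' x + T2 y)"
proof -
  have H: "closed_csubspace H1" "closed_csubspace H2" "closed_csubspace H1'" "closed_csubspace H2'"
    using dec dec' unfolding orth_decomp_def by auto
  note b = adjoint_onD(1)[OF T1] adjoint_onD(1)[OF E] adjoint_onD(1)[OF T2]
  note b' = adjoint_onD(2)[OF T1] adjoint_onD(2)[OF E] adjoint_onD(2)[OF T2]
  have Tx: "T (x + y) = (T11 x + E y) + T22 y" if "x \<in> H1" "y \<in> H2" for x y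
    unfolding T block_op_def by (simp add: orth_decomp_proj[OF dec that])
  then show "x \<in> H1 \<Longrightarrow> y \<in> H2 \<Longrightarrow> T (x + y) = (T11 x + E y) + T22 y" .
  assume x: "x \<in> H1'" and y: "y \<in> H2'"
  note m' = bounded_opD(1)[OF b'(1) x] bounded_opD(1)[OF b'(2) x] bounded_opD(1)[OF b'(3) y]
  show "adj UNIV T (x + y) = T1 x + (E' x + T2 y)"
  proof (rule adj_eqI[OF closed_csubspace_UNIV])
    fix z :: 'a and c :: complex
    obtain u v where uv: "z = u + v" "u \<in> H1" "v \<in> H2" by (rule orth_decomp_cases[OF dec])
    note m = bounded_opD(1)[OF b(1) uv(2)] bounded_opD(1)[OF b(2) uv(3)] bounded_opD(1)[OF b(3) uv(3)]
    show "T (c *\<^sub>C z) = c *\<^sub>C T z"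
      using uv by (simp add: scaleC_add_right Tx closed_csubspaceD(3)[OF H(1)] closed_csubspaceD(3)[OF H(2)]
          bounded_opD(3)[OF b(1)] bounded_opD(3)[OF b(2)] bounded_opD(3)[OF b(3)])
    show "T z \<bullet> (x + y) = z \<bullet> (T1 x + (E' x + T2 y))"
      unfolding uv(1) Tx[OF uv(2,3)] inner_add_left inner_add_right
      using adjoint_onD(3)[OF T1 uv(2) x] adjoint_onD(3)[OF E uv(3) x] adjoint_onD(3)[OF T2 uv(3) y]
        orth_decomp_inner[OF dec' m(1) y] orth_decomp_inner[OF dec' m(2) y] orth_decomp_inner[OF dec' x m(3)]
        orth_decomp_inner[OF dec uv(2) m'(2)] orth_decomp_inner[OF dec uv(2) m'(3)]
        orth_decomp_inner[OF dec m'(1) uv(3)] by simp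
  qed simp
qed

theorem proposition5p2:
  fixes H1 H2 H1' H2' \<H>1 \<H>2 :: "'a::complex_hilbert set"
    and T11 T22 K D1 D2 TK G S G11 G12 G22 S11 S21 S22 Y Z :: "'a \<Rightarrow> 'a"
  assumes separable: "separable_space (euclidean :: 'a topology)"
    and decomp: "orth_decomp H1 H2"
    and decomp': "orth_decomp H1' H2'"
    and T11: "bounded_op H1 H1' T11" "op_norm H1 T11 \<le> 1"
    and T22: "bounded_op H2 H2' T22" "op_norm H2 T22 \<le> 1"
    and D1: "D1 = defect_op H1' (adj H1 T11)"
    and D2: "D2 = defect_op H2 T22"
    and \<H>1: "\<H>1 = closure (D1 ` H1')"
    and \<H>2: "\<H>2 = closure (D2 ` H2)"
    and K: "bounded_op \<H>2 \<H>1 K"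
    and TK: "TK = block_op H1 H2 T11 (\<lambda>x. D1 (K (D2 x))) (\<lambda>x. 0) T22"
    and G: "G = (\<lambda>x. x - adj UNIV TK (TK x))"
    and S: "S = (\<lambda>x. x - TK (adj UNIV TK x))"
    and G11: "G11 = block_entry H1 G"  \<comment> \<open>used on H1\<close>
    and G12: "G12 = block_entry H1 G"  \<comment> \<open>used on H2\<close>
    and G22: "G22 = block_entry H2 G"  \<comment> \<open>used on H2\<close>
    and S11: "S11 = block_entry H1' S"  \<comment> \<open>used on H1'\<close>
    and S21: "S21 = block_entry H2' S"  \<comment> \<open>used on H1'\<close>
    and S22: "S22 = block_entry H2' S"  \<comment> \<open>used on H2'\<close>
    and Y: "Y = inv_sqrt_comp H1 G11 G12"
    and Z: "Z = inv_sqrt_comp H2' S22 S21"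
  shows
    "(positive_op H1 G11 \<and> G12 ` H2 \<subseteq> sqrt_op H1 G11 ` H1 \<and>
      (\<forall>x\<in>H2. \<exists>!y. is_inv_sqrt H1 G11 (G12 x) y) \<and> bounded_op H2 H1 Y \<and>
      positive_op H2' S22 \<and> S21 ` H1' \<subseteq> sqrt_op H2' S22 ` H2' \<and>
      (\<forall>x\<in>H1'. \<exists>!z. is_inv_sqrt H2' S22 (S21 x) z) \<and> bounded_op H1' H2' Z) \<and>
     ((\<forall>x\<in>H2. G22 x - adj H2 Y (Y x) = D2 (D2 x - adj \<H>2 K (K (D2 x)))) \<and>
      (\<forall>x\<in>H1'. S11 x - adj H1' Z (Z x) = D1 (D1 x - K (adj \<H>2 K (D1 x)))))"
proof -
  have H: "closed_csubspace H1" "closed_csubspace H2" "closed_csubspace H1'" "closed_csubspace H2'"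
    using decomp decomp' unfolding orth_decomp_def by auto
  note z = closed_csubspaceD(4)[OF H(1)] closed_csubspaceD(4)[OF H(2)]
    closed_csubspaceD(4)[OF H(3)] closed_csubspaceD(4)[OF H(4)]
  define T1 T2 K' where "T1 = adj H1 T11" and "T2 = adj H2 T22" and "K' = adj \<H>2 K"
  have aT1: "adjoint_on H1 H1' T11 T1" unfolding T1_def by (rule adjoint_on_adj[OF T11(1) H(1)])
  have aT2: "adjoint_on H2 H2' T22 T2" unfolding T2_def by (rule adjoint_on_adj[OF T22(1) H(2)])
  note aT1' = adjoint_on_sym[OF aT1] and aT2' = adjoint_on_sym[OF aT2]
  have le1: "\<forall>x\<in>H1. norm (T11 x) \<le> norm x" by (intro ballI op_norm_le_1D[OF T11 _ H(1)])
  have le2: "\<forall>x\<in>H2. norm (T22 x) \<le> norm x" by (intro ballI op_norm_le_1D[OF T22 _ H(2)])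
  note sc1 = symmetric_contraction_compose[OF aT1 le1] and sc2 = symmetric_contraction_compose[OF aT2 le2]
  \<comment> \<open>\<open>D1\<close> contains the double adjoint
    \<open>adj H1' (adj H1 T11)\<close>, which agrees with \<open>T11\<close> on
    \<open>H1\<close>.\<close>
  have D1': "D1 = sqrt_op H1' (\<lambda>y. y - T11 (T1 y))"
    unfolding D1 defect_op_def T1_def[symmetric]
    by (rule sqrt_op_cong) (simp add: adj_eq[OF aT1' H(3)] bounded_opD(1)[OF adjoint_onD(2)[OF aT1]])
  have D2': "D2 = sqrt_op H2 (\<lambda>y. y - T2 (T22 y))"
    unfolding D2 defect_op_def T2_def ..
  note D1s = positive_sqrt_defect[OF H(3) sc1(3) D1', folded \<H>1]
  note D2s = positive_sqrt_defect[OF H(2) sc2(2) D2', folded \<H>2]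
  have aK: "adjoint_on \<H>2 \<H>1 K K'" unfolding K'_def by (rule adjoint_on_adj[OF K D2s(4)])
  have aL: "adjoint_on H2 \<H>1 (\<lambda>x. K (D2 x)) (\<lambda>y. D2 (K' y))"
    by (rule adjoint_on_compose[OF D2s(3) aK])
  have aL': "adjoint_on H1' \<H>2 (\<lambda>x. K' (D1 x)) (\<lambda>y. D1 (K y))"
    by (rule adjoint_on_compose[OF D1s(3) adjoint_on_sym[OF aK]])
  have aE: "adjoint_on H2 H1' (\<lambda>x. D1 (K (D2 x))) (\<lambda>y. D2 (K' (D1 y)))"
    by (rule adjoint_on_compose[OF aL adjoint_on_sym[OF D1s(3)]])
  note TKv = adj_block_upper_triangular[OF decomp decomp' aT1 aE aT2 TK]
  note p = orth_decomp_proj[OF decomp] and p' = orth_decomp_proj[OF decomp']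
  note zero = bounded_opD'(1)[OF T11(1) H(1)] bounded_opD'(1)[OF T22(1) H(2)]
    bounded_opD'(1)[OF adjoint_onD(2)[OF aT1] H(3)] bounded_opD'(1)[OF adjoint_onD(2)[OF aT2] H(4)]
    bounded_opD'(1)[OF adjoint_onD(1)[OF aE] H(2)] bounded_opD'(1)[OF adjoint_onD(2)[OF aE] H(3)]
  note mem = bounded_opD(1)[OF T11(1)] bounded_opD(1)[OF T22(1)]
    bounded_opD(1)[OF adjoint_onD(2)[OF aT1]] bounded_opD(1)[OF adjoint_onD(2)[OF aT2]]
    bounded_opD(1)[OF adjoint_onD(1)[OF aE]] bounded_opD(1)[OF adjoint_onD(2)[OF aE]]
  note sub = closed_csubspaceD(6)[OF H(1)] closed_csubspaceD(6)[OF H(2)]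
    closed_csubspaceD(6)[OF H(3)] closed_csubspaceD(6)[OF H(4)]
  have G1: "G x = (x - T1 (T11 x)) + (- D2 (K' (D1 (T11 x))))" if x: "x \<in> H1" for x
    using TKv(1)[OF x z(2)] TKv(2)[OF mem(1)[OF x] z(4)] unfolding G zero by simp
  have G2: "G x = - T1 (D1 (K (D2 x))) + (x - T2 (T22 x) - D2 (K' (D1 (D1 (K (D2 x))))))"
    if x: "x \<in> H2" for x
    using TKv(1)[OF z(1) x] TKv(2)[OF mem(5)[OF x] mem(2)[OF x]] unfolding G zero by simp
  have S1: "S x = (x - T11 (T1 x) - D1 (K (D2 (D2 (K' (D1 x)))))) + (- T22 (D2 (K' (D1 x))))"
    if x: "x \<in> H1'" for x
    using TKv(2)[OF x z(4)] TKv(1)[OF mem(3)[OF x] mem(6)[OF x]] unfolding S zero by simp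
  have S2: "S x = (- D1 (K (D2 (T2 x)))) + (x - T22 (T2 x))" if x: "x \<in> H2'" for x
    using TKv(2)[OF z(3) x] TKv(1)[OF z(1) mem(4)[OF x]] unfolding S zero by simp
  have G11x: "\<forall>x\<in>H1. G11 x = x - T1 (T11 x)"
  proof
    fix x assume x: "x \<in> H1"
    show "G11 x = x - T1 (T11 x)"
        unfolding G11 block_entry_def G1[OF x]
        by (intro p(1) sub closed_csubspaceD(7)[OF H(2)] mem x)
  qed
  have G12x: "\<forall>x\<in>H2. G12 x = - T1 (D1 (K (D2 x)))"
  proof
    fix x assume x: "x \<in> H2"
    show "G12 x = - T1 (D1 (K (D2 x)))"
        unfolding G12 block_entry_def G2[OF x]
        by (intro p(1) sub closed_csubspaceD(7)[OF H(1)] mem x mem(4)[OF mem(2)])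
  qed
  have G22x: "G22 x = x - T2 (T22 x) - D2 (K' (D1 (D1 (K (D2 x)))))" if x: "x \<in> H2" for x
    unfolding G22 block_entry_def G2[OF x]
    by (intro p(2) sub closed_csubspaceD(7)[OF H(1)] mem x mem(4)[OF mem(2)])
  have S11x: "S11 x = x - T11 (T1 x) - D1 (K (D2 (D2 (K' (D1 x)))))" if x: "x \<in> H1'" for x
    unfolding S11 block_entry_def S1[OF x]
    by (intro p'(1) sub closed_csubspaceD(7)[OF H(4)] mem x)
  have S21x: "\<forall>x\<in>H1'. S21 x = - T22 (D2 (K' (D1 x)))"
  proof
    fix x assume x: "x \<in> H1'"
    show "S21 x = - T22 (D2 (K' (D1 x)))"
        unfolding S21 block_entry_def S1[OF x]
        by (intro p'(2) sub closed_csubspaceD(7)[OF H(4)] mem x)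
  qed
  have S22x: "\<forall>x\<in>H2'. S22 x = x - T22 (T2 x)"
  proof
    fix x assume x: "x \<in> H2'"
    show "S22 x = x - T22 (T2 x)"
        unfolding S22 block_entry_def S2[OF x]
        by (intro p'(2) sub closed_csubspaceD(7)[OF H(3)] mem x)
  qed
  \<comment> \<open>L is K D2 with adjoint D2 K' here; for \<open>CZ\<close> the contraction is T2 =
    T22* and L is K' D1 with adjoint D1 K.\<close>
  note CY = defect_completion[OF H(1,3,2) aT1 le1 D1' aL[unfolded \<H>1] G11x G12x Y]
  note CZ = defect_completion[OF H(4,2) H(3) aT2' sc2(1) D2' aL'[unfolded \<H>2] S22x S21x Z]
  have "G22 x - adj H2 Y (Y x) = D2 (D2 x - adj \<H>2 K (K (D2 x)))" if x: "x \<in> H2" for x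
  proof -
    have m: "D2 x \<in> H2" "K' (K (D2 x)) \<in> H2"
      using bounded_opD(1)[OF adjoint_onD(1)[OF D2s(1)] x] D2s(5)
        bounded_opD(1)[OF adjoint_onD(2)[OF aK] bounded_opD(1)[OF adjoint_onD(1)[OF aL] x]] by auto
    \<comment> \<open>The term D2 K' D1 D1 K D2 occurs with the same sign in \<open>G22\<close> and
      in Y* Y, so it cancels and leaves D2 D2 - D2 K' K D2.\<close>
    show ?thesis
      unfolding K'_def[symmetric] bounded_opD'(3)[OF adjoint_onD(1)[OF D2s(1)] H(2) m]
        CY(5)[OF x] G22x[OF x] D2s(2)[OF x] by simp
  qed
  moreover have "S11 x - adj H1' Z (Z x) = D1 (D1 x - K (adj \<H>2 K (D1 x)))" if x: "x \<in> H1'" for x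
  proof -
    have m: "D1 x \<in> H1'" "K (K' (D1 x)) \<in> H1'"
      using bounded_opD(1)[OF adjoint_onD(1)[OF D1s(1)] x] D1s(5)
        bounded_opD(1)[OF adjoint_onD(1)[OF aK] bounded_opD(1)[OF adjoint_onD(1)[OF aL'] x]] by auto
    show ?thesis
      unfolding K'_def[symmetric] bounded_opD'(3)[OF adjoint_onD(1)[OF D1s(1)] H(3) m]
        CZ(5)[OF x] S11x[OF x] D1s(2)[OF x] by simp
  qed
  ultimately show ?thesis using CY(1-4) CZ(1-4) by blast
qed

end
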